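(* The Euclidean projection $P_{\mathcal{K}_{\mathrm{exp}}}:\mathbf{R}^3\to\mathbf{R}^3$ onto the exponential cone $\mathcal{K}_{\mathrm{exp}}=\{(x,y,z):x\in\mathbf{R},\,y>0,\,z\ge y\exp(x/y)\}\cup\{(x,0,z):x\le0,\,z\ge0\}$ is semismooth.
   Context: For a locally Lipschitz map $F:\mathbf{R}^k\to\mathbf{R}^k$ (differentiable almost everywhere), the generalized Jacobian $\mathcal{J}(z)$ at $z$ is the convex hull of all limits $\lim_{i\to\infty}DF(z_i)$ over sequences $z_i\to z$ of points at which $F$ is differentiable. $F$ is semismooth if it is (i) locally Lipschitz; (ii) directionally differentiable at every point in every direction; and (iii) for every $z\in\mathbf{R}^k$, $$\lim_{\delta\to0,\ J\in\mathcal{J}(z+\delta)}\frac{\|F(z+\delta)-F(z)-J\delta\|_2}{\|\delta\|_2}=0.$$ *)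

theory Defs
  imports "HOL-Analysis.Analysis"
begin

definition locally_lipschitz :: "(real ^ 'k \<Rightarrow> real ^ 'k) \<Rightarrow> bool"
  where "locally_lipschitz F \<longleftrightarrow> (\<forall>z. \<exists>r>0. \<exists>L. L-lipschitz_on (ball z r) F)"

definition directionally_differentiable :: "(real ^ 'k \<Rightarrow> real ^ 'k) \<Rightarrow> bool"
  where "directionally_differentiable F \<longleftrightarrow>
    (\<forall>z d. \<exists>l. ((\<lambda>t. (F (z + t *\<^sub>R d) - F z) /\<^sub>R t) \<longlongrightarrow> l) (at_right 0))"

definition generalized_jacobian ::
    "(real ^ 'k \<Rightarrow> real ^ 'k) \<Rightarrow> real ^ 'k \<Rightarrow> (real ^ 'k ^ 'k) set"
  where "generalized_jacobian F z =
    convex hull {J. \<exists>s :: nat \<Rightarrow> real ^ 'k.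
      s \<longlonglongrightarrow> z \<and> (\<forall>i. F differentiable (at (s i))) \<and>
      (\<lambda>i. jacobian F (at (s i))) \<longlonglongrightarrow> J}"

text \<open>
  The limit in the third clause is joint in the increment and in the choice of the matrix,
  so the bound has to hold uniformly over all of \<open>generalized_jacobian F (z + \<delta>)\<close>.
\<close>

definition semismooth :: "(real ^ 'k \<Rightarrow> real ^ 'k) \<Rightarrow> bool"
  where "semismooth F \<longleftrightarrow>
    locally_lipschitz F \<and>
    directionally_differentiable F \<and>
    (\<forall>z. \<forall>\<epsilon>>0. \<exists>\<eta>>0. \<forall>\<delta>. 0 < norm \<delta> \<and> norm \<delta> < \<eta> \<longrightarrow>
      (\<forall>J \<in> generalized_jacobian F (z + \<delta>).
        norm (F (z + \<delta>) - F z - J *v \<delta>) / norm \<delta> < \<epsilon>))"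

definition exp_cone :: "(real ^ 3) set"
  where "exp_cone =
    {vector [x, y, z] | x y z. y > 0 \<and> z \<ge> y * exp (x / y)} \<union>
    {vector [x, 0, z] | x z. x \<le> 0 \<and> z \<ge> 0}"

end

theory Submission
  imports Defs "HOL-Real_Asymp.Real_Asymp"
begin

text \<open>
  Let \<open>p(r) = (r, 1, e\<^sup>r)\<close> span the rays of the curved boundary of the cone and let
  \<open>q(r) = (1, 1 - r, -e\<^sup>-\<^sup>r)\<close> be the outer normals there. The projection \<open>F\<close> is linear on the cone,
  on its polar, and on the octants \<open>x, y \<le> 0 \<le> z\<close> and \<open>x, y, z \<le> 0\<close>; every other point is
  \<open>w = a p(r) + b q(r)\<close> with \<open>a, b > 0\<close>, and \<open>F(w) = a p(r)\<close>. With the orthonormal frame \<open>P, Q, N\<close> along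
  \<open>p\<close>, \<open>q\<close>, \<open>q \<times> p\<close>, a derivative at \<open>w\<close> has to be \<open>DF(w) = P P\<^sup>T + \<lambda> N N\<^sup>T\<close> with \<open>\<lambda>\<close> in \<open>[0, 1]\<close>.

  Since \<open>F\<close> is positively homogeneous, \<open>F(w) - F(z) - DF(w)(w - z) = DF(w) z - F(z)\<close>, and since \<open>w\<close> is
  orthogonal to \<open>N\<close>, \<open>\<bar>z \<bullet> N\<bar> \<le> \<parallel>w - z\<parallel>\<close>. As \<open>w\<close> tends to \<open>z \<noteq> 0\<close>, \<open>r\<close> tends to a finite limit or to
  \<open>\<plusminus>\<infinity>\<close>; in each of the three cases the components of \<open>DF(w) z - F(z)\<close> in the frame are compared
  with \<open>z \<bullet> N\<close> and \<open>w - z\<close>. The same comparison yields the directional derivatives. The bound on \<open>DF(w)\<close>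
  passes to limits and to convex combinations, hence to the generalized Jacobian.
\<close>

unbundle cross3_syntax

section \<open>The orthogonal frame along the curved boundary\<close>

definition pv :: "real \<Rightarrow> real ^ 3"
  where "pv r = vector [r, 1, exp r]"

definition qv :: "real \<Rightarrow> real ^ 3"
  where "qv r = vector [1, 1 - r, - exp (- r)]"

definition nv :: "real \<Rightarrow> real ^ 3"
  where "nv r = qv r \<times> pv r"

lemma inner_3: "(x :: real ^ 3) \<bullet> y = x$1 * y$1 + x$2 * y$2 + x$3 * y$3"
  by (simp add: inner_vec_def sum_3)

lemma pv_nth [simp]: "pv r $ 1 = r" "pv r $ 2 = 1" "pv r $ 3 = exp r"
  by (simp_all add: pv_def)

lemma qv_nth [simp]: "qv r $ 1 = 1" "qv r $ 2 = 1 - r" "qv r $ 3 = - exp (- r)"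
  by (simp_all add: qv_def)

lemma exp_minus_mult [simp]: "exp (- r) * exp r = 1" "exp r * exp (- r) = (1::real)"
  by (simp_all add: exp_minus)

lemma nv_nth [simp]:
  "nv r $ 1 = exp (- r) + (1 - r) * exp r"
  "nv r $ 2 = - (exp r + r * exp (- r))"
  "nv r $ 3 = 1 - r + r\<^sup>2"
  by (simp_all add: nv_def cross3_simps power2_eq_square algebra_simps)

lemma pv_nz [simp]: "pv r \<noteq> 0" and qv_nz [simp]: "qv r \<noteq> 0"
  by (auto simp: vec_eq_iff forall_3)

lemma inner_pv_qv [simp]: "pv r \<bullet> qv r = 0"
  by (simp add: inner_3)

lemma inner_qv_pv [simp]: "qv r \<bullet> pv r = 0"
  by (simp add: inner_3)

lemma inner_nv [simp]: "pv r \<bullet> nv r = 0" "qv r \<bullet> nv r = 0" "nv r \<bullet> pv r = 0" "nv r \<bullet> qv r = 0"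
  by (simp_all add: nv_def dot_cross_self)

lemma norm_nv: "norm (nv r) = norm (pv r) * norm (qv r)"
  using norm_cross_dot[of "qv r" "pv r"]
  by (simp add: nv_def mult.commute power_mult_distrib[symmetric])

lemma nv_nz [simp]: "nv r \<noteq> 0"
  by (metis norm_nv norm_eq_zero mult_eq_0_iff pv_nz qv_nz)

lemma frame_expansion:
  "v = (v \<bullet> sgn (pv r)) *\<^sub>R sgn (pv r) + (v \<bullet> sgn (qv r)) *\<^sub>R sgn (qv r) + (v \<bullet> sgn (nv r)) *\<^sub>R sgn (nv r)"
proof -
  define P Q N where "P = sgn (pv r)" and "Q = sgn (qv r)" and "N = sgn (nv r)"
  have on: "P \<bullet> P = 1" "Q \<bullet> Q = 1" "N \<bullet> N = 1" "P \<bullet> Q = 0" "P \<bullet> N = 0" "Q \<bullet> N = 0"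
    "Q \<bullet> P = 0" "N \<bullet> P = 0" "N \<bullet> Q = 0"
    by (simp_all add: P_def Q_def N_def sgn_div_norm dot_square_norm power2_eq_square)
  have N: "Q \<times> P = N"
    by (simp add: P_def Q_def N_def sgn_div_norm norm_nv[unfolded nv_def] nv_def cross_mult_left cross_mult_right)
  define w where "w = v - (v \<bullet> P) *\<^sub>R P - (v \<bullet> Q) *\<^sub>R Q - (v \<bullet> N) *\<^sub>R N"
  have w: "w \<bullet> P = 0" "w \<bullet> Q = 0" "w \<bullet> N = 0"
    unfolding w_def by (simp_all add: inner_diff_left on)
  \<comment> \<open>Since \<open>N\<close> is the cross product of \<open>Q\<close> and
    \<open>P\<close>, the triple product formula makes \<open>w\<close> parallel to
    \<open>N\<close>; it is also orthogonal to \<open>N\<close>, hence zero.\<close>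
  have "w \<times> N = 0"
    unfolding N[symmetric] Lagrange using w by simp
  then have "w = 0"
    using norm_cross_dot[of w N] w on by (auto simp: norm_eq_sqrt_inner)
  then show ?thesis
    unfolding w_def P_def Q_def N_def by (simp add: algebra_simps)
qed

subsection \<open>The cone, its polar, and the projection\<close>

text \<open>The half-spaces contain the cone by 1 + t \<le> exp t at t = x / y - r. Conversely, the
  limits of the inequalities at -\<infinity> and \<infinity> give the signs of the coordinates, and
  one well-chosen half-space gives the curved inequality. In this form closedness and convexity are
  immediate.\<close>

lemma exp_cone_eq: "exp_cone = {v. \<forall>r. qv r \<bullet> v \<le> 0}"
proof (intro set_eqI iffI CollectI)
  fix v assume "v \<in> exp_cone"
  then consider x y z where "v = vector [x, y, z]" "y > 0" "z \<ge> y * exp (x / y)"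
    | x z where "v = vector [x, 0, z]" "x \<le> 0" "z \<ge> 0"
    unfolding exp_cone_def by auto
  then show "\<forall>r. qv r \<bullet> v \<le> 0"
  proof cases
    case 1
    show ?thesis
    proof
      fix r
      have "1 + (x / y - r) \<le> exp (x / y - r)"
        by (rule exp_ge_add_one_self)
      then have "y * (1 + (x / y - r)) \<le> y * exp (x / y - r)"
        using \<open>y > 0\<close> by simp
      moreover have "y * (1 + (x / y - r)) = x + (1 - r) * y"
        using \<open>y > 0\<close> by (simp add: field_simps)
      ultimately have "x + (1 - r) * y \<le> y * exp (x / y - r)"
        by simp
      also have "\<dots> = exp (- r) * (y * exp (x / y))"
        by (simp add: exp_diff exp_minus field_simps)
      also have "\<dots> \<le> exp (- r) * z"
        using 1 by simp
      finally show "qv r \<bullet> v \<le> 0"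
        using 1 by (simp add: inner_3)
    qed
  next
    case 2
    then show ?thesis
      by (auto simp: inner_3 intro: order_trans[of _ 0])
  qed
next
  fix v :: "real ^ 3" assume "v \<in> {v. \<forall>r. qv r \<bullet> v \<le> 0}"
  then have h: "v$1 + (1 - r) * v$2 - exp (- r) * v$3 \<le> 0" for r
    by (simp add: inner_3)
  have v: "v = vector [v$1, v$2, v$3]"
    by (simp add: vec_eq_iff forall_3)
  have z: "v$3 \<ge> 0"
  proof -
    have "((\<lambda>r. exp r * (v$1 + (1 - r) * v$2 - exp (- r) * v$3)) \<longlongrightarrow> - v$3) at_bot"
      by real_asymp
    moreover have "exp r * (v$1 + (1 - r) * v$2 - exp (- r) * v$3) \<le> 0" for r
      using h[of r] by (simp add: mult_nonneg_nonpos)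
    ultimately have "- v$3 \<le> 0"
      by (intro tendsto_upperbound[where F = "at_bot :: real filter"]) auto
    then show ?thesis by simp
  qed
  have y: "v$2 \<ge> 0"
  proof -
    have "((\<lambda>r. (v$1 + (1 - r) * v$2 - exp (- r) * v$3) / r) \<longlongrightarrow> - v$2) at_top"
      by real_asymp
    moreover have "\<forall>\<^sub>F r in at_top. (v$1 + (1 - r) * v$2 - exp (- r) * v$3) / r \<le> 0"
      using eventually_gt_at_top[of 0] by eventually_elim (use h in \<open>auto simp: divide_nonpos_pos\<close>)
    ultimately have "- v$2 \<le> 0"
      by (intro tendsto_upperbound[where F = "at_top :: real filter"]) auto
    then show ?thesis by simp
  qed
  show "v \<in> exp_cone"
  proof (cases "v$2 = 0")
    case True
    have "((\<lambda>r. v$1 - exp (- r) * v$3) \<longlongrightarrow> v$1) at_top"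
      by real_asymp
    moreover have "v$1 - exp (- r) * v$3 \<le> 0" for r
      using h[of r] True by simp
    ultimately have "v$1 \<le> 0"
      by (intro tendsto_upperbound[where F = "at_top :: real filter"]) auto
    then show ?thesis
      unfolding exp_cone_def using z True v by auto
  next
    case False
    then have y: "v$2 > 0" using y by simp
    \<comment> \<open>The tightest half-space: with x = \<open>v$1\<close> and y =
      \<open>v$2\<close>, the value r = x / y maximises exp r (x + (1 - r) y).\<close>
    have "v$2 \<le> exp (- (v$1 / v$2)) * v$3"
      using h[of "v$1 / v$2"] y by (simp add: field_simps)
    then have "v$2 * exp (v$1 / v$2) \<le> v$3"
      by (simp add: exp_minus field_simps)
    then show ?thesis
      unfolding exp_cone_def using y v by blast
  qed
qed

lemma exp_coneD:
  assumes "v \<in> exp_cone"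
  shows "v$2 \<ge> 0" "v$3 \<ge> 0" "v$2 = 0 \<Longrightarrow> v$1 \<le> 0" "v$2 > 0 \<Longrightarrow> v$3 \<ge> v$2 * exp (v$1 / v$2)"
  using assms unfolding exp_cone_def 
  by (auto intro: order_trans[rotated])

lemma closed_exp_cone: "closed exp_cone"
  unfolding exp_cone_eq Collect_all_eq by (intro closed_INT ballI closed_halfspace_le)

lemma convex_exp_cone: "convex exp_cone"
  unfolding exp_cone_eq Collect_all_eq by (intro convex_INT convex_halfspace_le)

lemma exp_cone_0 [simp]: "0 \<in> exp_cone"
  by (simp add: exp_cone_eq)

lemma exp_cone_nonempty: "exp_cone \<noteq> {}"
  using exp_cone_0 by blast

lemma exp_cone_scaleR: "v \<in> exp_cone \<Longrightarrow> c \<ge> 0 \<Longrightarrow> c *\<^sub>R v \<in> exp_cone"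
  by (auto simp: exp_cone_eq mult_nonneg_nonpos)

lemma pv_in_exp_cone: "pv r \<in> exp_cone"
proof -
  have "qv s \<bullet> pv r \<le> 0" for s
    using exp_ge_add_one_self[of "r - s"] by (simp add: inner_3 exp_diff exp_minus field_simps)
  then show ?thesis by (simp add: exp_cone_eq)
qed

abbreviation proj :: "real ^ 3 \<Rightarrow> real ^ 3"
  where "proj \<equiv> closest_point exp_cone"

lemma proj_in: "proj v \<in> exp_cone"
  by (rule closest_point_in_set[OF closed_exp_cone exp_cone_nonempty])

text \<open>Moreau's conditions: in a cone the variational inequality of the closest point may be
  tested at \<open>0\<close> and at twice the projection, which yields orthogonality and then the
  sign.\<close>

lemma proj_normal: "k \<in> exp_cone \<Longrightarrow> (v - proj v) \<bullet> k \<le> 0"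
  and proj_orth: "(v - proj v) \<bullet> proj v = 0"
proof -
  have dot: "(v - proj v) \<bullet> (k - proj v) \<le> 0" if "k \<in> exp_cone" for k
    using closest_point_dot[OF convex_exp_cone closed_exp_cone that] .
  have "(v - proj v) \<bullet> (0 - proj v) \<le> 0" "(v - proj v) \<bullet> (2 *\<^sub>R proj v - proj v) \<le> 0"
    by (rule dot, simp add: exp_cone_scaleR proj_in)+
  then show *: "(v - proj v) \<bullet> proj v = 0"
    by (simp add: scaleR_2 inner_minus_right)
  show "k \<in> exp_cone \<Longrightarrow> (v - proj v) \<bullet> k \<le> 0"
    using dot[of k] * by (simp add: inner_diff_right)
qed

text \<open>Moreau's conditions are also sufficient: they fix the sign of the cross term when the
  squared distance is expanded around \<open>k\<close>.\<close>

lemma proj_eqI: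
  assumes "k \<in> exp_cone" "(v - k) \<bullet> k = 0" "\<And>x. x \<in> exp_cone \<Longrightarrow> (v - k) \<bullet> x \<le> 0"
  shows "proj v = k"
proof (rule closest_point_unique[OF convex_exp_cone closed_exp_cone assms(1), symmetric, of v])
  show "\<forall>x\<in>exp_cone. dist v k \<le> dist v x"
  proof
    fix x assume "x \<in> exp_cone"
    then have "(v - k) \<bullet> (x - k) \<le> 0"
      using assms by (simp add: inner_diff_right)
    moreover have "(norm (v - x))\<^sup>2 = (norm (v - k))\<^sup>2 + (norm (x - k))\<^sup>2 - 2 * ((v - k) \<bullet> (x - k))"
      by (simp add: power2_norm_eq_inner inner_diff_left inner_diff_right inner_commute algebra_simps)
    ultimately have "(norm (v - k))\<^sup>2 \<le> (norm (v - x))\<^sup>2"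
      by (smt (verit) zero_le_power2)
    then show "dist v k \<le> dist v x"
      by (simp add: dist_norm)
  qed
qed

lemma proj_lipschitz: "norm (proj v - proj w) \<le> norm (v - w)"
  using closest_point_lipschitz[OF convex_exp_cone closed_exp_cone exp_cone_nonempty, of v w]
  by (simp add: dist_norm)

lemma continuous_on_proj: "continuous_on S proj"
  by (rule continuous_on_closest_point[OF convex_exp_cone closed_exp_cone exp_cone_nonempty])

definition curved :: "(real ^ 3) set"
  where "curved = {a *\<^sub>R pv r + b *\<^sub>R qv r |a b r. a > 0 \<and> b > 0}"

text \<open>By \<open>exp_cone_eq\<close> the vector \<open>qv r\<close> is polar to the cone, and
  it is orthogonal to \<open>pv r\<close>, so the two summands form a Moreau decomposition.\<close>

lemma proj_frame:
  assumes "a \<ge> 0" "b \<ge> 0"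
  shows "proj (a *\<^sub>R pv r + b *\<^sub>R qv r) = a *\<^sub>R pv r"
proof (rule proj_eqI)
  show "a *\<^sub>R pv r \<in> exp_cone"
    by (intro exp_cone_scaleR pv_in_exp_cone assms)
  show "(a *\<^sub>R pv r + b *\<^sub>R qv r - a *\<^sub>R pv r) \<bullet> x \<le> 0" if "x \<in> exp_cone" for x
    using that assms by (simp add: exp_cone_eq mult_nonneg_nonpos)
qed simp

definition polar_cone :: "(real ^ 3) set"
  where "polar_cone = {v. \<forall>r. pv r \<bullet> v \<le> 0}"

text \<open>The rays \<open>pv r\<close> turn towards the edges (0, 0, 1) and (-1, 0, 0) as
  \<open>r\<close> tends to \<infinity> and -\<infinity>; dividing by the dominant coefficient and
  passing to the limit gives the first two signs. If \<open>g$1 = 0\<close>, the limit at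
  -\<infinity> exposes the second component.\<close>

lemma normal_signs:
  assumes "\<And>r. pv r \<bullet> g \<le> 0"
  shows "g$1 \<ge> 0" "g$3 \<le> 0" "g$1 = 0 \<Longrightarrow> g$2 \<le> 0"
proof -
  have h: "r * g$1 + g$2 + exp r * g$3 \<le> 0" for r
    using assms[of r] by (simp add: inner_3)
  have "((\<lambda>r. (r * g$1 + g$2 + exp r * g$3) / exp r) \<longlongrightarrow> g$3) at_top"
    by real_asymp
  moreover have "(r * g$1 + g$2 + exp r * g$3) / exp r \<le> 0" for r
    using h[of r] by (simp add: divide_nonpos_pos)
  ultimately show "g$3 \<le> 0"
    by (intro tendsto_upperbound[where F = "at_top :: real filter"]) auto
  have "((\<lambda>r. (r * g$1 + g$2 + exp r * g$3) / (- r)) \<longlongrightarrow> - g$1) at_bot"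
    by real_asymp
  moreover have "\<forall>\<^sub>F r in at_bot. (r * g$1 + g$2 + exp r * g$3) / (- r) \<le> 0"
    using eventually_gt_at_bot[of 0] eventually_le_at_bot[of "-1::real"] by eventually_elim (use h in \<open>auto intro!: divide_nonpos_pos simp del: divide_minus_right\<close>)
  ultimately have "- g$1 \<le> 0"
    by (intro tendsto_upperbound[where F = "at_bot :: real filter"]) auto
  then show "g$1 \<ge> 0" by simp
  assume 0: "g$1 = 0"
  have "((\<lambda>r. g$2 + exp r * g$3) \<longlongrightarrow> g$2) at_bot"
    by real_asymp
  moreover have "g$2 + exp r * g$3 \<le> 0" for r
    using h[of r] 0 by simp
  ultimately show "g$2 \<le> 0"
    by (intro tendsto_upperbound[where F = "at_bot :: real filter"]) auto
qed

text \<open>\<open>polar_cone\<close> tests only the curved boundary. Every other point of the cone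
  arises by adding a multiple of (0, 0, 1) to a boundary ray, or lies on the flat face spanned by
  (-1, 0, 0) and (0, 0, 1); \<open>normal_signs\<close> settles these directions.\<close>

lemma proj_polar_cone:
  assumes "v \<in> polar_cone"
  shows "proj v = 0"
proof (rule proj_eqI)
  have v: "pv r \<bullet> v \<le> 0" for r using assms by (simp add: polar_cone_def)
  note sg = normal_signs[OF v]
  show "(v - 0) \<bullet> x \<le> 0" if x: "x \<in> exp_cone" for x
  proof (cases "x$2 = 0")
    case True
    then show ?thesis using exp_coneD[OF x] sg 
      by (simp add: inner_3 add_nonpos_nonpos mult_nonneg_nonpos mult_nonpos_nonneg)
  next
    case False
    then have y: "x$2 > 0" using exp_coneD[OF x] by simp
    have "x = x$2 *\<^sub>R pv (x$1 / x$2) + vector [0, 0, x$3 - x$2 * exp (x$1 / x$2)]"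
      using y by (simp add: vec_eq_iff forall_3)
    then have "v \<bullet> x = x$2 * (pv (x$1 / x$2) \<bullet> v) + v$3 * (x$3 - x$2 * exp (x$1 / x$2))"
      by (metis (no_types) inner_3 inner_add_right inner_commute inner_scaleR_left vector_3 mult_zero_right add_0)
    also have "\<dots> \<le> 0"
      using y v sg exp_coneD[OF x] by (intro add_nonpos_nonpos mult_nonneg_nonpos mult_nonpos_nonneg) auto
    finally show ?thesis by simp
  qed
qed auto

definition "quad_up = {v :: real ^ 3. v$1 \<le> 0 \<and> v$2 \<le> 0 \<and> v$3 \<ge> 0}"
definition "quad_dn = {v :: real ^ 3. v$1 \<le> 0 \<and> v$2 \<le> 0 \<and> v$3 \<le> 0}"

lemma vector_x0z_in_exp_cone: "x \<le> 0 \<Longrightarrow> z \<ge> 0 \<Longrightarrow> vector [x, 0, z] \<in> exp_cone"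
  unfolding exp_cone_def by auto

lemma proj_quad_up: "v \<in> quad_up \<Longrightarrow> proj v = vector [v$1, 0, v$3]"
  by (rule proj_eqI)
    (auto simp: quad_up_def vector_x0z_in_exp_cone inner_3 dest: exp_coneD intro: mult_nonpos_nonneg)

lemma proj_quad_dn: "v \<in> quad_dn \<Longrightarrow> proj v = vector [v$1, 0, 0]"
  by (rule proj_eqI)
    (auto simp: quad_dn_def vector_x0z_in_exp_cone inner_3 exp_coneD(1,2) intro!: mult_nonpos_nonneg add_nonpos_nonpos)

text \<open>Case analysis on the Moreau decomposition \<open>v = f + g\<close>. If \<open>f\<close>
  is on the flat face, complementarity of the components leads to the polar cone or to an octant.
  Otherwise \<open>g\<close> vanishes or is a normal at the curved boundary.\<close>

lemma cover: "v \<in> exp_cone \<or> v \<in> polar_cone \<or> v \<in> quad_up \<or> v \<in> quad_dn \<or> v \<in> curved"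
proof -
  define f g where "f = proj v" and "g = v - proj v"
  have v: "v = f + g" by (simp add: f_def g_def)
  have f: "f \<in> exp_cone" and fg: "g \<bullet> f = 0" 
    by (simp_all add: f_def g_def proj_in proj_orth)
  have g: "pv r \<bullet> g \<le> 0" for r
    using proj_normal[OF pv_in_exp_cone, of v r] by (simp add: g_def inner_commute)
  note sg = normal_signs[OF g]
  show ?thesis
  proof (cases "f$2 = 0")
    case True
    have x: "f$1 \<le> 0" and z: "f$3 \<ge> 0" using True exp_coneD[OF f] by auto
    have "g$1 * f$1 + g$3 * f$3 = 0"
      using fg True by (simp add: inner_3)
    moreover have "g$1 * f$1 \<le> 0" "g$3 * f$3 \<le> 0"
      using x z sg by (simp_all add: mult_nonneg_nonpos mult_nonpos_nonneg)
    ultimately have 0: "g$1 * f$1 = 0" "g$3 * f$3 = 0" by linarith+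
    have "v \<in> polar_cone" if "f = 0" using that v g by (simp add: polar_cone_def)
    moreover have "v \<in> quad_up \<or> v \<in> quad_dn" if "f \<noteq> 0"
    proof -
      have g1: "g$1 = 0"
      proof (rule ccontr)
        assume "g$1 \<noteq> 0"
        then have g1: "g$1 > 0" and "f$1 = 0" using sg 0 by auto
        then have "f$3 \<noteq> 0" using \<open>f \<noteq> 0\<close> True by (auto simp: vec_eq_iff forall_3)
        then have "g$3 = 0" using 0 by simp
        \<comment> \<open>At this \<open>r\<close> the inner product \<open>pv r \<bullet> g\<close>
          equals 1.\<close>
        then show False
          using g[of "(1 - g$2) / g$1"] g1 by (simp add: inner_3)
      qed
      then have "g$2 \<le> 0" using sg by simp
      then show ?thesis
        using g1 x z sg 0 True by (auto simp: v quad_up_def quad_dn_def)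
    qed
    ultimately show ?thesis by blast
  next
    case False
    define a where "a = f$2"
    define r where "r = f$1 / a"
    have a: "a > 0" using False exp_coneD[OF f] by (simp add: a_def)
    have f3: "f$3 \<ge> a * exp r" using exp_coneD[OF f] a by (simp add: a_def r_def)
    have "f = a *\<^sub>R pv r + vector [0, 0, f$3 - a * exp r]"
      using a by (simp add: vec_eq_iff forall_3 a_def r_def)
    then have "g \<bullet> f = a * (pv r \<bullet> g) + g$3 * (f$3 - a * exp r)"
      by (metis (no_types) inner_3 inner_add_right inner_commute inner_scaleR_left vector_3 mult_zero_right add_0)
    moreover have "a * (pv r \<bullet> g) \<le> 0" "g$3 * (f$3 - a * exp r) \<le> 0"
      using a g[of r] sg f3 by (auto intro: mult_nonneg_nonpos mult_nonpos_nonneg)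
    ultimately have 0: "pv r \<bullet> g = 0" "g$3 * (f$3 - a * exp r) = 0"
      using fg a by (auto simp: algebra_simps add_nonpos_eq_0_iff)
    \<comment> \<open>The function is nonpositive everywhere and zero at \<open>r\<close>, so it has
      a maximum there. Hence \<open>g\<close> is orthogonal to the tangent (1, 0, exp r) as well as
      to \<open>pv r\<close>, which leaves only multiples of \<open>qv r\<close>.\<close>
    have "((\<lambda>r. pv r \<bullet> g) has_real_derivative g$1 + exp r * g$3) (at r)"
      unfolding inner_3 pv_nth by (auto intro!: derivative_eq_intros)
    then have d: "g$1 + exp r * g$3 = 0"
      using DERIV_local_max[of "\<lambda>r. pv r \<bullet> g" _ r 1] g 0 by auto
    have g_eq: "g = (exp r * (- g$3)) *\<^sub>R qv r"
    proof -
      have 1: "g$1 = exp r * (- g$3)" using d by simp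
      have 2: "g$2 = exp r * (- g$3) * (1 - r)"
        using 0(1) unfolding inner_3 pv_nth 1 by (simp add: algebra_simps)
      have "exp r * (exp (- r) * g$3) = g$3"
        by (simp add: exp_minus)
      then show ?thesis using 1 2 by (simp add: vec_eq_iff forall_3)
    qed
    show ?thesis
    proof (cases "g$3 = 0")
      case True
      then show ?thesis using g_eq v f by simp
    next
      case False
      then have "g$3 < 0" "f$3 = a * exp r" using sg 0 by auto
      then have "f = a *\<^sub>R pv r" using a by (simp add: vec_eq_iff forall_3 a_def r_def)
      then have "v \<in> curved"
        unfolding curved_def v using g_eq \<open>g$3 < 0\<close> a
        by (intro CollectI exI[of _ a] exI[of _ r] exI[of _ "exp r * (- g$3)"]) (auto simp: mult_pos_neg)
      then show ?thesis by blast
    qed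
  qed
qed

subsection \<open>Derivatives of the projection\<close>

text \<open>Reads off a given derivative on the tangent of a curve along which \<open>F\<close> is
  explicit. Differentiability of \<open>F\<close> stays a hypothesis throughout; only the value of
  the derivative is determined.\<close>

lemma has_derivative_along_curve:
  fixes F :: "'a::real_normed_vector \<Rightarrow> 'b::real_normed_vector"
  assumes F: "(F has_derivative D) (at (\<gamma> t))"
    and \<gamma>: "(\<gamma> has_vector_derivative g) (at t within S)"
    and eq: "\<And>s. s \<in> S \<Longrightarrow> F (\<gamma> s) = \<phi> s" and t: "t \<in> S"
    and \<phi>: "(\<phi> has_vector_derivative h) (at t within S)"
    and S: "at t within S \<noteq> bot"
  shows "D g = h"
proof -
  interpret D: bounded_linear D by (rule has_derivative_bounded_linear[OF F])
  have "((\<lambda>s. F (\<gamma> s)) has_derivative (\<lambda>s. D (s *\<^sub>R g))) (at t within S)"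
    using F \<gamma> unfolding has_vector_derivative_def by (rule has_derivative_compose[rotated])
  then have "((\<lambda>s. F (\<gamma> s)) has_vector_derivative D g) (at t within S)"
    by (simp add: has_vector_derivative_def D.scaleR)
  then have "(\<phi> has_vector_derivative D g) (at t within S)"
    by (rule has_vector_derivative_transform[OF t, rotated]) (simp add: eq)
  then show ?thesis
    using vector_derivative_unique_within[OF S _ \<phi>] by simp
qed

text \<open>The point \<open>w\<close> may lie on the boundary of \<open>A\<close>. Segments from
  \<open>w\<close> into \<open>A\<close> determine \<open>D\<close> on all differences
  \<open>x - w\<close>, and these span the space because \<open>A\<close> contains a ball.\<close>

lemma derivative_on_linear_piece:
  fixes F :: "'a::real_normed_vector \<Rightarrow> 'b::real_normed_vector"
  assumes A: "convex A" "ball c e \<subseteq> A" "e > 0" and L: "bounded_linear L" "\<And>x. x \<in> A \<Longrightarrow> F x = L x"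
    and w: "w \<in> A" and F: "(F has_derivative D) (at w)"
  shows "D = L"
proof
  interpret L: bounded_linear L by fact
  interpret D: bounded_linear D by (rule has_derivative_bounded_linear[OF F])
  have *: "D (x - w) = L (x - w)" if "x \<in> A" for x
  proof (rule has_derivative_along_curve[where F = F and \<gamma> = "\<lambda>t. w + t *\<^sub>R (x - w)" and t = 0 and S = "{0..1}"
        and \<phi> = "\<lambda>t. L w + t *\<^sub>R L (x - w)"])
    show "F (w + s *\<^sub>R (x - w)) = L w + s *\<^sub>R L (x - w)" if "s \<in> {0..1}" for s
    proof -
      have "w + s *\<^sub>R (x - w) = (1 - s) *\<^sub>R w + s *\<^sub>R x" by (simp add: algebra_simps)
      also have "\<dots> \<in> A"
        using that by (intro convexD_alt A w \<open>x \<in> A\<close>) auto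
      finally show ?thesis using L(2) by (simp add: L.add L.scaleR)
    qed
  qed (use F in \<open>auto intro!: derivative_eq_intros simp: trivial_limit_within islimpt_Icc\<close>)
  fix u :: 'a
  \<comment> \<open>This brings \<open>c + s *\<^sub>R u\<close> into the ball; the added 1 covers
    \<open>u = 0\<close>. Subtracting the identities at this point and at \<open>c\<close>
    eliminates \<open>w\<close>.\<close>
  define s where "s = e / 2 / (norm u + 1)"
  have s: "s > 0" using A by (simp add: s_def add_nonneg_pos)
  have "norm (s *\<^sub>R u) = e / 2 * (norm u / (norm u + 1))"
    using A(3) by (simp add: s_def abs_of_pos)
  also have "\<dots> < e * 1"
    using A by (intro mult_strict_mono) (auto simp: divide_less_eq add_nonneg_pos)
  finally have "c + s *\<^sub>R u \<in> A" "c \<in> A"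
    using A by (auto simp: dist_norm subset_eq)
  from this[THEN *] have "D (c + s *\<^sub>R u - w) - D (c - w) = L (c + s *\<^sub>R u - w) - L (c - w)"
    by simp
  then have "s *\<^sub>R D u = s *\<^sub>R L u"
    by (simp add: L.diff L.add L.scaleR D.diff D.add D.scaleR)
  then show "D u = L u" using s by simp
qed

definition pv' :: "real \<Rightarrow> real ^ 3"
  where "pv' r = vector [1, 0, exp r]"

definition qv' :: "real \<Rightarrow> real ^ 3"
  where "qv' r = vector [0, - 1, exp (- r)]"

lemma has_vector_derivative_3:
  fixes f :: "real \<Rightarrow> real ^ 3"
  assumes "((\<lambda>x. f x $ 1) has_real_derivative d$1) (at x within S)"
    "((\<lambda>x. f x $ 2) has_real_derivative d$2) (at x within S)"
    "((\<lambda>x. f x $ 3) has_real_derivative d$3) (at x within S)"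
  shows "(f has_vector_derivative d) (at x within S)"
proof -
  have "f = (\<lambda>x. f x $ 1 *\<^sub>R axis 1 1 + f x $ 2 *\<^sub>R axis 2 1 + f x $ 3 *\<^sub>R axis 3 1)"
    by (simp add: fun_eq_iff vec_eq_iff forall_3 axis_def)
  moreover have "d = d$1 *\<^sub>R axis 1 1 + d$2 *\<^sub>R axis 2 1 + d$3 *\<^sub>R axis 3 1"
    by (simp add: vec_eq_iff forall_3 axis_def)
  moreover have "((\<lambda>x. f x $ 1 *\<^sub>R axis 1 1 + f x $ 2 *\<^sub>R axis 2 1 + f x $ 3 *\<^sub>R (axis 3 1 :: real ^ 3))
     has_vector_derivative d$1 *\<^sub>R axis 1 1 + d$2 *\<^sub>R axis 2 1 + d$3 *\<^sub>R axis 3 1) (at x within S)"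
    by (intro has_vector_derivative_add)
      (use assms in \<open>auto intro!: derivative_eq_intros\<close>)
  ultimately show ?thesis by metis
qed

lemma pv_derivative [derivative_intros]: "(pv has_vector_derivative pv' r) (at r within S)"
  by (rule has_vector_derivative_3) (auto simp: pv'_def intro!: derivative_eq_intros)

lemma qv_derivative [derivative_intros]: "(qv has_vector_derivative qv' r) (at r within S)"
  by (rule has_vector_derivative_3) (auto simp: qv'_def intro!: derivative_eq_intros)

text \<open>The derivative of each of \<open>pv\<close>, \<open>qv\<close> is orthogonal to the
  other vector, and its component along \<open>nv r\<close> is positive. Both facts make the matrix
  of the derivative of the projection diagonal in the frame, with eigenvalue \<open>lam\<close>
  strictly between 0 and 1 when \<open>a\<close> and \<open>b\<close> are positive.\<close>

lemma frame_derivatives: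
  "pv' r \<bullet> qv r = 0" "qv' r \<bullet> pv r = 0"
  "pv' r \<bullet> nv r = exp r * (qv r \<bullet> qv r)" "qv' r \<bullet> nv r = exp (- r) * (pv r \<bullet> pv r)"
proof -
  have 1: "exp r * exp (-r) = 1" by simp
  show "pv' r \<bullet> qv r = 0" "qv' r \<bullet> pv r = 0"
    by (simp_all add: inner_3 pv'_def qv'_def)
  show "pv' r \<bullet> nv r = exp r * (qv r \<bullet> qv r)"
    by (simp add: inner_3 pv'_def) (use 1 in algebra)
  show "qv' r \<bullet> nv r = exp (- r) * (pv r \<bullet> pv r)"
    by (simp add: inner_3 qv'_def) (use 1 in algebra)
qed

text \<open>The eigenvalue on \<open>nv r\<close> of a derivative at
  \<open>a *\<^sub>R pv r + b *\<^sub>R qv r\<close>: varying \<open>r\<close> moves the point along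
  \<open>a *\<^sub>R pv' r + b *\<^sub>R qv' r\<close> and its projection along
  \<open>a *\<^sub>R pv' r\<close>, and the quotient compares their components along
  \<open>nv r\<close>.\<close>

definition lam :: "real \<Rightarrow> real \<Rightarrow> real \<Rightarrow> real"
  where "lam a b r = a * (pv' r \<bullet> nv r) / (a * (pv' r \<bullet> nv r) + b * (qv' r \<bullet> nv r))"

lemma frame_derivatives_pos: "pv' r \<bullet> nv r > 0" "qv' r \<bullet> nv r > 0"
  by (simp_all add: frame_derivatives)

text \<open>Varying \<open>a\<close>, \<open>b\<close> and \<open>r\<close> separately gives three
  curves on which the projection is explicit; their tangents span the space and so determine
  \<open>D\<close>.\<close>

lemma proj_derivative_curved:
  assumes a: "a > 0" and b: "b > 0" and D: "(proj has_derivative D) (at (a *\<^sub>R pv r + b *\<^sub>R qv r))"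
  shows "D v = (v \<bullet> sgn (pv r)) *\<^sub>R sgn (pv r) + (lam a b r * (v \<bullet> sgn (nv r))) *\<^sub>R sgn (nv r)"
proof -
  interpret D: bounded_linear D by (rule has_derivative_bounded_linear[OF D])
  have Dp: "D (pv r) = pv r"
    by (rule has_derivative_along_curve[where F = proj and \<gamma> = "\<lambda>t. (a + t) *\<^sub>R pv r + b *\<^sub>R qv r" and t = 0 and S = "{-a<..<a}"
        and \<phi> = "\<lambda>t. (a + t) *\<^sub>R pv r"])
      (use a b D in \<open>auto intro!: derivative_eq_intros proj_frame simp: trivial_limit_within islimpt_greaterThanLessThan1\<close>)
  have Dq: "D (qv r) = 0"
    by (rule has_derivative_along_curve[where F = proj and \<gamma> = "\<lambda>t. a *\<^sub>R pv r + (b + t) *\<^sub>R qv r" and t = 0 and S = "{-b<..<b}"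
        and \<phi> = "\<lambda>t. a *\<^sub>R pv r"])
      (use a b D in \<open>auto intro!: derivative_eq_intros proj_frame simp: trivial_limit_within islimpt_greaterThanLessThan1\<close>)
  define T where "T = a *\<^sub>R pv' r + b *\<^sub>R qv' r"
  have DT: "D T = a *\<^sub>R pv' r"
    by (rule has_derivative_along_curve[where F = proj and \<gamma> = "\<lambda>t. a *\<^sub>R pv t + b *\<^sub>R qv t" and t = r and S = UNIV
        and \<phi> = "\<lambda>t. a *\<^sub>R pv t"])
      (use a b D in \<open>auto intro!: derivative_eq_intros proj_frame simp: T_def\<close>)
  define P Q N where "P = sgn (pv r)" and "Q = sgn (qv r)" and "N = sgn (nv r)"
  have DPQ: "D P = P" "D Q = 0"
    by (simp_all add: P_def Q_def sgn_div_norm D.scaleR Dp Dq)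
  define \<beta> \<delta> where "\<beta> = a * (pv' r \<bullet> nv r)" and "\<delta> = b * (qv' r \<bullet> nv r)"
  have pos: "\<beta> > 0" "\<delta> > 0"
    unfolding \<beta>_def \<delta>_def by (intro mult_pos_pos frame_derivatives_pos a b)+
  have TP: "T \<bullet> P = a * (pv' r \<bullet> P)" and pQ: "pv' r \<bullet> Q = 0"
    by (simp_all add: T_def P_def Q_def sgn_div_norm inner_add_left frame_derivatives)
  have TN: "T \<bullet> N = (\<beta> + \<delta>) / norm (nv r)" and pN: "a * (pv' r \<bullet> N) = \<beta> / norm (nv r)"
    by (simp_all add: T_def N_def sgn_div_norm \<beta>_def \<delta>_def inner_add_left field_simps)
  have "T = (T \<bullet> P) *\<^sub>R P + (T \<bullet> Q) *\<^sub>R Q + (T \<bullet> N) *\<^sub>R N"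
    unfolding P_def Q_def N_def by (rule frame_expansion)
  then have "D T = D ((T \<bullet> P) *\<^sub>R P + (T \<bullet> Q) *\<^sub>R Q + (T \<bullet> N) *\<^sub>R N)"
    by simp
  also have "\<dots> = (a * (pv' r \<bullet> P)) *\<^sub>R P + (T \<bullet> N) *\<^sub>R D N"
    by (simp add: D.add D.scaleR DPQ TP)
  finally have 1: "a *\<^sub>R pv' r = (a * (pv' r \<bullet> P)) *\<^sub>R P + (T \<bullet> N) *\<^sub>R D N"
    by (simp add: DT)
  have "pv' r = (pv' r \<bullet> P) *\<^sub>R P + (pv' r \<bullet> Q) *\<^sub>R Q + (pv' r \<bullet> N) *\<^sub>R N"
    unfolding P_def Q_def N_def by (rule frame_expansion)
  then have "a *\<^sub>R pv' r = a *\<^sub>R ((pv' r \<bullet> P) *\<^sub>R P + (pv' r \<bullet> N) *\<^sub>R N)"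
    using pQ by simp
  \<comment> \<open>The \<open>P\<close> components of \<open>T\<close> and of
    \<open>a *\<^sub>R pv' r\<close> agree and cancel.\<close>
  with 1 have "(T \<bullet> N) *\<^sub>R D N = (a * (pv' r \<bullet> N)) *\<^sub>R N"
    by (simp add: scaleR_add_right)
  then have "((\<beta> + \<delta>) / norm (nv r)) *\<^sub>R D N = ((\<beta> + \<delta>) / norm (nv r)) *\<^sub>R (lam a b r *\<^sub>R N)"
    using pos unfolding TN pN by (simp add: lam_def \<beta>_def[symmetric] \<delta>_def[symmetric])
  then have DN: "D N = lam a b r *\<^sub>R N"
    using pos by (simp del: scaleR_scaleR)
  have "D v = D ((v \<bullet> P) *\<^sub>R P + (v \<bullet> Q) *\<^sub>R Q + (v \<bullet> N) *\<^sub>R N)"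
    unfolding P_def Q_def N_def using frame_expansion[of v r] by simp
  also have "\<dots> = (v \<bullet> P) *\<^sub>R P + (lam a b r * (v \<bullet> N)) *\<^sub>R N"
    by (simp add: D.add D.scaleR DPQ DN mult.commute)
  finally show ?thesis by (simp add: P_def N_def)
qed

section \<open>Error estimates for points of the curved region\<close>

lemma curved_frame:
  assumes "w = a *\<^sub>R pv r + b *\<^sub>R qv r" "a > 0" "b > 0"
  shows "w \<bullet> sgn (nv r) = 0" "proj w = (w \<bullet> sgn (pv r)) *\<^sub>R sgn (pv r)"
  using assms by (simp_all add: proj_frame sgn_div_norm inner_add_left power2_norm_eq_inner[symmetric] power2_eq_square)

text \<open>The coordinates are a mere choice from the definition of \<open>curved\<close>; their
  behaviour near \<open>z\<close> is derived from continuity of \<open>proj\<close>.\<close>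

locale curved_approach =
  fixes z :: "real ^ 3" and \<alpha> \<beta> \<rho> :: "real ^ 3 \<Rightarrow> real"
  assumes param: "\<And>w. w \<in> curved \<Longrightarrow> \<alpha> w > 0 \<and> \<beta> w > 0 \<and> w = \<alpha> w *\<^sub>R pv (\<rho> w) + \<beta> w *\<^sub>R qv (\<rho> w)"
begin

abbreviation "P w \<equiv> sgn (pv (\<rho> w))"
abbreviation "Q w \<equiv> sgn (qv (\<rho> w))"
abbreviation "N w \<equiv> sgn (nv (\<rho> w))"

lemma inner_N_eq:
  assumes "w \<in> curved"
  shows "z \<bullet> N w = - ((w - z) \<bullet> N w)"
  using param[OF assms] curved_frame(1)[of w "\<alpha> w" "\<rho> w" "\<beta> w"] by (simp add: inner_diff_left)

text \<open>Expanding \<open>proj z\<close> in the frame at \<open>w\<close> reduces the discrepancy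
  to three scalar coefficients, the ones that \<open>curved_limit\<close> compares with
  \<open>z \<bullet> N w\<close>.\<close>

lemma proj_diff:
  "((z \<bullet> P w) *\<^sub>R P w - proj z) =
    ((z - proj z) \<bullet> P w) *\<^sub>R P w - (proj z \<bullet> Q w) *\<^sub>R Q w - (proj z \<bullet> N w) *\<^sub>R N w"
  using frame_expansion[of "proj z" "\<rho> w"] by (simp add: inner_diff_left algebra_simps)

lemma inner_N_bigo: "(\<lambda>w. z \<bullet> N w) \<in> O[at z within curved](\<lambda>w. norm (w - z))"
proof (rule bigoI[of _ 1])
  show "\<forall>\<^sub>F w in at z within curved. norm (z \<bullet> N w) \<le> 1 * norm (norm (w - z))"
    unfolding eventually_at_filter
  proof (intro always_eventually allI impI)
    fix w assume "w \<in> curved"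
    then show "norm (z \<bullet> N w) \<le> 1 * norm (norm (w - z))"
      using Cauchy_Schwarz_ineq2[of "w - z" "N w"] inner_N_eq[of w] by (simp add: norm_sgn)
  qed
qed

end

text \<open>
  The filter \<open>\<Phi>\<close> is where the parameter \<open>\<rho>\<close> tends to: \<open>nhds r\<close>, \<open>at_top\<close> or \<open>at_bot\<close>. The limiting
  derivative at \<open>z\<close> in directions pointing into the curved region is \<open>P0 P0\<^sup>T + \<kappa> N0 N0\<^sup>T\<close>. The factor
  \<open>lam - \<kappa>\<close> itself need not be small: at the end points \<open>\<plusminus>\<infinity>\<close> it may depend on the path, and
  then only its product with \<open>z \<bullet> N\<close> is small compared with \<open>w - z\<close>.
\<close>

locale curved_limit = curved_approach +
  fixes \<Phi> :: "real filter" and \<kappa> :: real and P0 N0 :: "real ^ 3"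
  assumes lim_\<rho>: "filterlim \<rho> \<Phi> (at z within curved)"
    and small_P: "(\<lambda>r. (z - proj z) \<bullet> sgn (pv r)) \<in> o[\<Phi>](\<lambda>r. z \<bullet> sgn (nv r))"
    and small_Q: "(\<lambda>r. proj z \<bullet> sgn (qv r)) \<in> o[\<Phi>](\<lambda>r. z \<bullet> sgn (nv r))"
    and small_N: "(\<lambda>r. proj z \<bullet> sgn (nv r) - \<kappa> * (z \<bullet> sgn (nv r))) \<in> o[\<Phi>](\<lambda>r. z \<bullet> sgn (nv r))"
    and small_lam: "(\<lambda>w. (lam (\<alpha> w) (\<beta> w) (\<rho> w) - \<kappa>) * (z \<bullet> sgn (nv (\<rho> w)))) \<in> o[at z within curved](\<lambda>w. norm (w - z))"
    and lim_P: "((\<lambda>r. sgn (pv r)) \<longlongrightarrow> P0) \<Phi>"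
    and lim_N: "((\<lambda>r. sgn (nv r)) \<longlongrightarrow> N0) \<Phi>"
begin

text \<open>Stated along an arbitrary approach to \<open>z\<close>: the identity serves the
  derivative error, the ray \<open>z + t *\<^sub>R d\<close> the directional derivative.\<close>

lemma small:
  assumes "filterlim w (at z within curved) G"
  shows "(\<lambda>t. (z - proj z) \<bullet> P (w t)) \<in> o[G](\<lambda>t. z \<bullet> N (w t))"
    "(\<lambda>t. proj z \<bullet> Q (w t)) \<in> o[G](\<lambda>t. z \<bullet> N (w t))"
    "(\<lambda>t. proj z \<bullet> N (w t) - \<kappa> * (z \<bullet> N (w t))) \<in> o[G](\<lambda>t. z \<bullet> N (w t))"
  using filterlim_compose[OF lim_\<rho> assms]
  by (intro landau_o.small.compose[OF small_P] landau_o.small.compose[OF small_Q] landau_o.small.compose[OF small_N]; simp)+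

lemma derivative_error:
  assumes "\<epsilon> > 0"
  shows "\<forall>\<^sub>F w in at z within curved. \<forall>D. (proj has_derivative D) (at w) \<longrightarrow>
    norm (proj w - proj z - D (w - z)) \<le> \<epsilon> * norm (w - z)"
proof -
  \<comment> \<open>One quarter for each of the four coefficients of the error.\<close>
  have e4: "\<epsilon> / 4 > 0" using assms by simp
  note sm = small[OF filterlim_ident, THEN landau_o.small_big_trans[OF _ inner_N_bigo]]
  have "\<forall>\<^sub>F w in at z within curved. w \<in> curved"
    by (simp add: eventually_at_filter)
  then show ?thesis
    using landau_o.smallD[OF sm(1) e4] landau_o.smallD[OF sm(2) e4] landau_o.smallD[OF sm(3) e4]
      landau_o.smallD[OF small_lam e4]
  proof eventually_elim
    case (elim w)
    show ?case
    proof (intro allI impI)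
      fix D assume D: "(proj has_derivative D) (at w)"
      interpret D: bounded_linear D by (rule has_derivative_bounded_linear[OF D])
      define l where "l = lam (\<alpha> w) (\<beta> w) (\<rho> w)"
      have w: "\<alpha> w > 0" "\<beta> w > 0" "w = \<alpha> w *\<^sub>R pv (\<rho> w) + \<beta> w *\<^sub>R qv (\<rho> w)"
        using param[OF elim(1)] by auto
      have Dv: "D v = (v \<bullet> P w) *\<^sub>R P w + (l * (v \<bullet> N w)) *\<^sub>R N w" for v
        unfolding l_def using w D by (intro proj_derivative_curved) auto
      have "D w = proj w"
        using curved_frame[OF w(3,1,2)] by (simp add: Dv)
      then have "D (w - z) = proj w - D z"
        by (simp only: D.diff)
      then have "proj w - proj z - D (w - z) = (z \<bullet> P w) *\<^sub>R P w - proj z + (l * (z \<bullet> N w)) *\<^sub>R N w"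
        by (simp add: Dv)
      \<comment> \<open>Inserting \<open>\<kappa> * (z \<bullet> N w)\<close> separates the
        deviation of the frame from the deviation of \<open>lam\<close> from
        \<open>\<kappa>\<close>.\<close>
      also have "\<dots> = ((z - proj z) \<bullet> P w) *\<^sub>R P w - (proj z \<bullet> Q w) *\<^sub>R Q w
          - (proj z \<bullet> N w - \<kappa> * (z \<bullet> N w)) *\<^sub>R N w + ((l - \<kappa>) * (z \<bullet> N w)) *\<^sub>R N w"
        unfolding proj_diff by (simp add: algebra_simps)
      also have "norm \<dots> \<le> norm ((z - proj z) \<bullet> P w) + norm (proj z \<bullet> Q w)
          + norm (proj z \<bullet> N w - \<kappa> * (z \<bullet> N w)) + norm ((l - \<kappa>) * (z \<bullet> N w))"
        by (intro norm_triangle_mono norm_triangle_le_diff add_mono) (simp_all add: norm_sgn)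
      also have "\<dots> \<le> \<epsilon> / 4 * norm (w - z) + \<epsilon> / 4 * norm (w - z) + \<epsilon> / 4 * norm (w - z) + \<epsilon> / 4 * norm (w - z)"
        using elim by (intro add_mono) (simp_all add: l_def)
      finally show "norm (proj w - proj z - D (w - z)) \<le> \<epsilon> * norm (w - z)"
        by simp
    qed
  qed
qed

text \<open>The projection along the ray is expanded in the moving frame. As
  \<open>z \<bullet> N\<close> equals \<open>- t * (d \<bullet> N)\<close>, the three small
  coefficients are o(t), while the \<open>N\<close> component of \<open>proj z\<close> contributes
  \<open>\<kappa> * (d \<bullet> N)\<close> to the quotient.\<close>

lemma directional_derivative:
  assumes "d \<noteq> 0" and ev: "\<forall>\<^sub>F t in at_right 0. z + t *\<^sub>R d \<in> curved"
  shows "((\<lambda>t. (proj (z + t *\<^sub>R d) - proj z) /\<^sub>R t) \<longlongrightarrow> (d \<bullet> P0) *\<^sub>R P0 + (\<kappa> * (d \<bullet> N0)) *\<^sub>R N0) (at_right 0)"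
proof -
  define w where "w = (\<lambda>t. z + t *\<^sub>R d)"
  have w: "filterlim w (at z within curved) (at_right 0)"
    unfolding filterlim_at
  proof
    show "(w \<longlongrightarrow> z) (at_right 0)" unfolding w_def by (auto intro!: tendsto_eq_intros)
    show "\<forall>\<^sub>F t in at_right 0. w t \<in> curved \<and> w t \<noteq> z"
      using ev eventually_at_right_less[of 0] by eventually_elim (use \<open>d \<noteq> 0\<close> in \<open>auto simp: w_def\<close>)
  qed
  have zN: "\<forall>\<^sub>F t in at_right 0. z \<bullet> N (w t) = - t * (d \<bullet> N (w t))"
    using ev by eventually_elim (use inner_N_eq in \<open>auto simp: w_def\<close>)
  have "(\<lambda>t. z \<bullet> N (w t)) \<in> O[at_right 0](\<lambda>t. t)"
  proof (rule bigoI[of _ "norm d"])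
    show "\<forall>\<^sub>F t in at_right 0. norm (z \<bullet> N (w t)) \<le> norm d * norm t"
      using zN
    proof eventually_elim
      case (elim t)
      then show ?case
        using Cauchy_Schwarz_ineq2[of d "N (w t)"] by (simp add: norm_sgn abs_mult mult.commute mult_left_mono)
    qed
  qed
  note sm = small[OF w, THEN landau_o.small_big_trans[OF _ this], THEN smalloD_tendsto]
  \<comment> \<open>Unit vectors are bounded, so a vanishing coefficient suffices; this handles
    \<open>Q\<close>, for which no limit is at hand.\<close>
  have null: "((\<lambda>t. (c t / t) *\<^sub>R sgn (v t)) \<longlongrightarrow> 0) (at_right 0)"
    if "((\<lambda>t. c t / t) \<longlongrightarrow> 0) (at_right 0)" for c :: "real \<Rightarrow> real" and v :: "real \<Rightarrow> real ^ 3"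
  proof (rule Lim_null_comparison)
    show "((\<lambda>t. norm (c t / t)) \<longlongrightarrow> 0) (at_right 0)" using tendsto_norm_zero[OF that] .
    show "\<forall>\<^sub>F t in at_right 0. norm ((c t / t) *\<^sub>R sgn (v t)) \<le> norm (c t / t)"
      by (simp add: norm_sgn)
  qed
  have lim: "((\<lambda>t. P (w t)) \<longlongrightarrow> P0) (at_right 0)" "((\<lambda>t. N (w t)) \<longlongrightarrow> N0) (at_right 0)"
    using filterlim_compose[OF lim_P filterlim_compose[OF lim_\<rho> w]]
      filterlim_compose[OF lim_N filterlim_compose[OF lim_\<rho> w]] by simp_all
  have "((\<lambda>t. (d \<bullet> P (w t)) *\<^sub>R P (w t) + (\<kappa> * (d \<bullet> N (w t))) *\<^sub>R N (w t)
      + (((z - proj z) \<bullet> P (w t)) / t) *\<^sub>R P (w t) - ((proj z \<bullet> Q (w t)) / t) *\<^sub>R Q (w t)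
      - ((proj z \<bullet> N (w t) - \<kappa> * (z \<bullet> N (w t))) / t) *\<^sub>R N (w t)) \<longlongrightarrow>
      (d \<bullet> P0) *\<^sub>R P0 + (\<kappa> * (d \<bullet> N0)) *\<^sub>R N0 + 0 - 0 - 0) (at_right 0)"
    by (intro tendsto_intros lim null sm)
  moreover have "\<forall>\<^sub>F t in at_right 0. (d \<bullet> P (w t)) *\<^sub>R P (w t) + (\<kappa> * (d \<bullet> N (w t))) *\<^sub>R N (w t)
      + (((z - proj z) \<bullet> P (w t)) / t) *\<^sub>R P (w t) - ((proj z \<bullet> Q (w t)) / t) *\<^sub>R Q (w t)
      - ((proj z \<bullet> N (w t) - \<kappa> * (z \<bullet> N (w t))) / t) *\<^sub>R N (w t) = (proj (z + t *\<^sub>R d) - proj z) /\<^sub>R t"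
    using ev zN eventually_at_right_less[of 0]
  proof eventually_elim
    case (elim t)
    have w: "\<alpha> (w t) > 0" "\<beta> (w t) > 0" "w t = \<alpha> (w t) *\<^sub>R pv (\<rho> (w t)) + \<beta> (w t) *\<^sub>R qv (\<rho> (w t))"
      using param[of "w t"] elim(1) by (auto simp: w_def)
    have "proj (z + t *\<^sub>R d) = (w t \<bullet> P (w t)) *\<^sub>R P (w t)"
      using curved_frame(2)[OF w(3,1,2)] by (simp add: w_def)
    also have "w t \<bullet> P (w t) = z \<bullet> P (w t) + t * (d \<bullet> P (w t))"
      by (simp add: w_def inner_add_left)
    finally have "proj (z + t *\<^sub>R d) - proj z =
        (t * (d \<bullet> P (w t))) *\<^sub>R P (w t) + ((z \<bullet> P (w t)) *\<^sub>R P (w t) - proj z)"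
      by (simp add: algebra_simps)
    also have "\<dots> = t *\<^sub>R ((d \<bullet> P (w t)) *\<^sub>R P (w t) + (\<kappa> * (d \<bullet> N (w t))) *\<^sub>R N (w t)
      + (((z - proj z) \<bullet> P (w t)) / t) *\<^sub>R P (w t) - ((proj z \<bullet> Q (w t)) / t) *\<^sub>R Q (w t)
      - ((proj z \<bullet> N (w t) - \<kappa> * (z \<bullet> N (w t))) / t) *\<^sub>R N (w t))"
      unfolding proj_diff using elim by (simp add: scaleR_add_right scaleR_diff_right scaleR_diff_left scaleR_add_left)
    finally show ?case using elim by simp
  qed
  ultimately show ?thesis
    using tendsto_cong by fastforce
qed

end

subsection \<open>The frame at the two ends of the curved boundary\<close>

lemma norm_pv: "norm (pv r) = sqrt (r * r + 1 + exp r * exp r)"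
  by (simp add: norm_eq_sqrt_inner inner_3)

lemma norm_qv: "norm (qv r) = sqrt (1 + (1 - r) * (1 - r) + exp (- r) * exp (- r))"
  by (simp add: norm_eq_sqrt_inner inner_3)

lemma sgn_nth: "sgn (v :: real ^ 3) $ i = v $ i / norm v"
  by (simp add: sgn_div_norm divide_inverse)

lemmas frame_unfold = sgn_nth norm_nv norm_pv norm_qv pv_nth qv_nth nv_nth

text \<open>Here \<open>f\<close> stands for \<open>proj z\<close> and \<open>g\<close> for
  \<open>z - proj z\<close>. Before normalisation, the inner product of \<open>f + g\<close> with
  \<open>nv r\<close> is A (1 - r + r^2) plus B times a term of order exp r. So for
  \<open>B > 0\<close> the part of \<open>f\<close> is negligible and \<open>\<kappa> = 0\<close>,
  while for \<open>B = 0\<close> it is everything and \<open>\<kappa> = 1\<close>.\<close>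

lemma small_frame_at_top:
  fixes f g :: "real ^ 3"
  assumes "f = vector [0, 0, A]" "g = vector [0, - B, 0]" "A \<ge> 0" "B \<ge> 0" "A > 0 \<or> B > 0"
    and "\<kappa> = (if B = 0 then 1 else 0)"
  shows "(\<lambda>r. g \<bullet> sgn (pv r)) \<in> o[at_top](\<lambda>r. (f + g) \<bullet> sgn (nv r))"
    "(\<lambda>r. f \<bullet> sgn (qv r)) \<in> o[at_top](\<lambda>r. (f + g) \<bullet> sgn (nv r))"
    "(\<lambda>r. f \<bullet> sgn (nv r) - \<kappa> * ((f + g) \<bullet> sgn (nv r))) \<in> o[at_top](\<lambda>r. (f + g) \<bullet> sgn (nv r))"
proof -
  consider "A > 0" "B = 0" | "A = 0" "B > 0" | "A > 0" "B > 0" using assms by linarith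
  note cases = this
  show "(\<lambda>r. g \<bullet> sgn (pv r)) \<in> o[at_top](\<lambda>r. (f + g) \<bullet> sgn (nv r))"
    by (cases rule: cases) (simp_all add: assms inner_3 frame_unfold, real_asymp+)
  show "(\<lambda>r. f \<bullet> sgn (qv r)) \<in> o[at_top](\<lambda>r. (f + g) \<bullet> sgn (nv r))"
    by (cases rule: cases) (simp_all add: assms inner_3 frame_unfold, real_asymp+)
  show "(\<lambda>r. f \<bullet> sgn (nv r) - \<kappa> * ((f + g) \<bullet> sgn (nv r))) \<in> o[at_top](\<lambda>r. (f + g) \<bullet> sgn (nv r))"
    by (cases rule: cases) (simp_all add: assms inner_3 frame_unfold, real_asymp+)
qed

text \<open>The counterpart at -\<infinity>: now the term with \<open>A\<close>, of order exp (-r),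
  dominates the term with \<open>B\<close>, of order r^2. Hence \<open>\<kappa> = 1\<close> unless
  \<open>A = 0\<close>.\<close>

lemma small_frame_at_bot:
  fixes f g :: "real ^ 3"
  assumes "f = vector [- A, 0, 0]" "g = vector [0, 0, - B]" "A \<ge> 0" "B \<ge> 0" "A > 0 \<or> B > 0"
    and "\<kappa> = (if A = 0 then 0 else 1)"
  shows "(\<lambda>r. g \<bullet> sgn (pv r)) \<in> o[at_bot](\<lambda>r. (f + g) \<bullet> sgn (nv r))"
    "(\<lambda>r. f \<bullet> sgn (qv r)) \<in> o[at_bot](\<lambda>r. (f + g) \<bullet> sgn (nv r))"
    "(\<lambda>r. f \<bullet> sgn (nv r) - \<kappa> * ((f + g) \<bullet> sgn (nv r))) \<in> o[at_bot](\<lambda>r. (f + g) \<bullet> sgn (nv r))"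
proof -
  consider "A > 0" "B = 0" | "A = 0" "B > 0" | "A > 0" "B > 0" using assms by linarith
  note cases = this
  show "(\<lambda>r. g \<bullet> sgn (pv r)) \<in> o[at_bot](\<lambda>r. (f + g) \<bullet> sgn (nv r))"
    by (cases rule: cases) (simp_all add: assms inner_3 frame_unfold, real_asymp+)
  show "(\<lambda>r. f \<bullet> sgn (qv r)) \<in> o[at_bot](\<lambda>r. (f + g) \<bullet> sgn (nv r))"
    by (cases rule: cases) (simp_all add: assms inner_3 frame_unfold, real_asymp+)
  show "(\<lambda>r. f \<bullet> sgn (nv r) - \<kappa> * ((f + g) \<bullet> sgn (nv r))) \<in> o[at_bot](\<lambda>r. (f + g) \<bullet> sgn (nv r))"
    by (cases rule: cases) (simp_all add: assms inner_3 frame_unfold, real_asymp+)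
qed

lemma tendsto_3:
  fixes f :: "'a \<Rightarrow> real ^ 3"
  assumes "((\<lambda>x. f x $ 1) \<longlongrightarrow> l $ 1) F" "((\<lambda>x. f x $ 2) \<longlongrightarrow> l $ 2) F" "((\<lambda>x. f x $ 3) \<longlongrightarrow> l $ 3) F"
  shows "(f \<longlongrightarrow> l) F"
proof (rule vec_tendstoI)
  fix i :: 3
  show "((\<lambda>x. f x $ i) \<longlongrightarrow> l $ i) F"
    using exhaust_3[of i] assms by auto
qed

lemma lim_frame_at_top:
  "((\<lambda>r. sgn (pv r)) \<longlongrightarrow> vector [0, 0, 1]) at_top"
  "((\<lambda>r. sgn (nv r)) \<longlongrightarrow> vector [-1, 0, 0]) at_top"
proof -
  show "((\<lambda>r. sgn (pv r)) \<longlongrightarrow> vector [0, 0, 1]) at_top"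
    by (rule tendsto_3; unfold frame_unfold vector_3; real_asymp)
  show "((\<lambda>r. sgn (nv r)) \<longlongrightarrow> vector [-1, 0, 0]) at_top"
    by (rule tendsto_3; unfold frame_unfold vector_3; real_asymp)
qed

lemma lim_frame_at_bot:
  "((\<lambda>r. sgn (pv r)) \<longlongrightarrow> vector [-1, 0, 0]) at_bot"
  "((\<lambda>r. sgn (nv r)) \<longlongrightarrow> vector [0, 1, 0]) at_bot"
proof -
  show "((\<lambda>r. sgn (pv r)) \<longlongrightarrow> vector [-1, 0, 0]) at_bot"
    by (rule tendsto_3; unfold frame_unfold vector_3; real_asymp)
  show "((\<lambda>r. sgn (nv r)) \<longlongrightarrow> vector [0, 1, 0]) at_bot"
    by (rule tendsto_3; unfold frame_unfold vector_3; real_asymp)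
qed

section \<open>Bounds on \<open>lam\<close> and limits of the coordinates\<close>

lemma lam_bounds:
  assumes "a > 0" "b > 0"
  shows "0 \<le> lam a b r" "lam a b r \<le> 1"
    "lam a b r \<le> a * (pv' r \<bullet> nv r) / (b * (qv' r \<bullet> nv r))"
    "1 - lam a b r \<le> b * (qv' r \<bullet> nv r) / (a * (pv' r \<bullet> nv r))"
proof -
  define X Y where "X = a * (pv' r \<bullet> nv r)" and "Y = b * (qv' r \<bullet> nv r)"
  have pos: "X > 0" "Y > 0" using assms frame_derivatives_pos by (simp_all add: X_def Y_def)
  have l: "lam a b r = X / (X + Y)" by (simp add: lam_def X_def Y_def)
  have 1: "1 - lam a b r = Y / (X + Y)" using pos unfolding l by (simp add: field_simps)
  show "0 \<le> lam a b r" "lam a b r \<le> 1" using pos unfolding l by simp_all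
  show "lam a b r \<le> a * (pv' r \<bullet> nv r) / (b * (qv' r \<bullet> nv r))"
    unfolding l X_def[symmetric] Y_def[symmetric] using pos by (intro divide_left_mono) auto
  show "1 - lam a b r \<le> b * (qv' r \<bullet> nv r) / (a * (pv' r \<bullet> nv r))"
    unfolding 1 X_def[symmetric] Y_def[symmetric] using pos by (intro divide_left_mono) auto
qed

context curved_approach
begin

abbreviation "G \<equiv> at z within curved"

lemma eventually_curved: "\<forall>\<^sub>F w in G. w \<in> curved"
  by (simp add: eventually_at_filter)

text \<open>The easy case: \<open>lam\<close> itself converges to \<open>\<kappa>\<close>, and
  \<open>z \<bullet> N w\<close> is already O(\<open>norm (w - z)\<close>).\<close>

lemma small_lam_of_tendsto:
  assumes "((\<lambda>w. lam (\<alpha> w) (\<beta> w) (\<rho> w)) \<longlongrightarrow> \<kappa>) G"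
  shows "(\<lambda>w. (lam (\<alpha> w) (\<beta> w) (\<rho> w) - \<kappa>) * (z \<bullet> N w)) \<in> o[G](\<lambda>w. norm (w - z))"
proof -
  have "((\<lambda>w. lam (\<alpha> w) (\<beta> w) (\<rho> w) - \<kappa>) \<longlongrightarrow> 0) G"
    using assms by (simp add: LIM_zero_iff)
  then have "(\<lambda>w. lam (\<alpha> w) (\<beta> w) (\<rho> w) - \<kappa>) \<in> o[G](\<lambda>_. 1 :: real)"
    by (intro smalloI_tendsto) auto
  from landau_o.small_big_mult[OF this inner_N_bigo] show ?thesis by simp
qed

lemma frame_coeff:
  assumes "w \<in> curved"
  shows "proj w = \<alpha> w *\<^sub>R pv (\<rho> w)" "w - proj w = \<beta> w *\<^sub>R qv (\<rho> w)"
proof -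
  have w: "\<alpha> w > 0" "\<beta> w > 0" "w = \<alpha> w *\<^sub>R pv (\<rho> w) + \<beta> w *\<^sub>R qv (\<rho> w)"
    using param[OF assms] by auto
  show 1: "proj w = \<alpha> w *\<^sub>R pv (\<rho> w)"
    using w by (metis proj_frame less_imp_le)
  show "w - proj w = \<beta> w *\<^sub>R qv (\<rho> w)"
    using w(3) unfolding 1 by (metis add_diff_cancel_left')
qed

text \<open>The two summands of \<open>w\<close> are \<open>proj w\<close> and
  \<open>w - proj w\<close>, and both are continuous in \<open>w\<close>.\<close>

lemma tendsto_frame:
  shows "((\<lambda>w. \<alpha> w *\<^sub>R pv (\<rho> w)) \<longlongrightarrow> proj z) G"
    and "((\<lambda>w. \<beta> w *\<^sub>R qv (\<rho> w)) \<longlongrightarrow> z - proj z) G"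
proof -
  have *: "(proj \<longlongrightarrow> proj z) G"
    using continuous_on_proj[of UNIV]
    by (meson UNIV_I continuous_on_def subset_UNIV tendsto_within_subset)
  then have "((\<lambda>w. w - proj w) \<longlongrightarrow> z - proj z) G"
    by (intro tendsto_intros)
  then show "((\<lambda>w. \<beta> w *\<^sub>R qv (\<rho> w)) \<longlongrightarrow> z - proj z) G"
    by (rule Lim_transform_eventually, use eventually_curved in eventually_elim) (rule frame_coeff)
  show "((\<lambda>w. \<alpha> w *\<^sub>R pv (\<rho> w)) \<longlongrightarrow> proj z) G"
    using * by (rule Lim_transform_eventually, use eventually_curved in eventually_elim) (rule frame_coeff)
qed

lemma tendsto_coeff:
  shows "((\<lambda>w. \<alpha> w * \<rho> w) \<longlongrightarrow> proj z $ 1) G" "(\<alpha> \<longlongrightarrow> proj z $ 2) G" "((\<lambda>w. \<alpha> w * exp (\<rho> w)) \<longlongrightarrow> proj z $ 3) G"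
    and "(\<beta> \<longlongrightarrow> (z - proj z) $ 1) G" "((\<lambda>w. \<beta> w * (1 - \<rho> w)) \<longlongrightarrow> (z - proj z) $ 2) G"
    "((\<lambda>w. \<beta> w * exp (- \<rho> w)) \<longlongrightarrow> - (z - proj z) $ 3) G"
proof -
  show "((\<lambda>w. \<alpha> w * \<rho> w) \<longlongrightarrow> proj z $ 1) G" "(\<alpha> \<longlongrightarrow> proj z $ 2) G" "((\<lambda>w. \<alpha> w * exp (\<rho> w)) \<longlongrightarrow> proj z $ 3) G"
    using tendsto_frame(1)[THEN tendsto_vec_nth, of 1] tendsto_frame(1)[THEN tendsto_vec_nth, of 2] 
      tendsto_frame(1)[THEN tendsto_vec_nth, of 3] by simp_all
  show "(\<beta> \<longlongrightarrow> (z - proj z) $ 1) G" "((\<lambda>w. \<beta> w * (1 - \<rho> w)) \<longlongrightarrow> (z - proj z) $ 2) G"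
    using tendsto_frame(2)[THEN tendsto_vec_nth, of 1] tendsto_frame(2)[THEN tendsto_vec_nth, of 2] by simp_all
  show "((\<lambda>w. \<beta> w * exp (- \<rho> w)) \<longlongrightarrow> - (z - proj z) $ 3) G"
    using tendsto_minus[OF tendsto_frame(2)[THEN tendsto_vec_nth, of 3]] by simp
qed

lemma pos_at: "\<forall>\<^sub>F w in G. \<alpha> w > 0 \<and> \<beta> w > 0"
  using eventually_curved by eventually_elim (use param in auto)

text \<open>Where a component vanishes at \<open>z\<close>, the Lipschitz bound for
  \<open>proj\<close> turns its convergence to 0 into a rate; for the residual the two Lipschitz
  bounds add up to the constant 2.\<close>

lemma coeff_bigo:
  shows "proj z $ i = 0 \<Longrightarrow> (\<lambda>w. \<alpha> w * pv (\<rho> w) $ i) \<in> O[G](\<lambda>w. norm (w - z))"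
    "(z - proj z) $ i = 0 \<Longrightarrow> (\<lambda>w. \<beta> w * qv (\<rho> w) $ i) \<in> O[G](\<lambda>w. norm (w - z))"
proof -
  show "(\<lambda>w. \<alpha> w * pv (\<rho> w) $ i) \<in> O[G](\<lambda>w. norm (w - z))" if "proj z $ i = 0"
  proof (rule bigoI[of _ 1])
    show "\<forall>\<^sub>F w in G. norm (\<alpha> w * pv (\<rho> w) $ i) \<le> 1 * norm (norm (w - z))"
      using eventually_curved
    proof eventually_elim
      case (elim w)
      have "\<alpha> w * pv (\<rho> w) $ i = (proj w - proj z) $ i"
        using that by (simp add: frame_coeff(1)[OF elim])
      also have "norm \<dots> \<le> norm (proj w - proj z)"
        by (rule Finite_Cartesian_Product.norm_nth_le)
      also have "\<dots> \<le> norm (w - z)" by (rule proj_lipschitz)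
      finally show ?case by simp
    qed
  qed
  show "(\<lambda>w. \<beta> w * qv (\<rho> w) $ i) \<in> O[G](\<lambda>w. norm (w - z))" if "(z - proj z) $ i = 0"
  proof (rule bigoI[of _ 2])
    show "\<forall>\<^sub>F w in G. norm (\<beta> w * qv (\<rho> w) $ i) \<le> 2 * norm (norm (w - z))"
      using eventually_curved
    proof eventually_elim
      case (elim w)
      have "\<beta> w * qv (\<rho> w) $ i = (w - proj w) $ i"
        by (simp only: frame_coeff(2)[OF elim] vector_scaleR_component) simp
      also have "\<dots> = ((w - z) - (proj w - proj z)) $ i"
        using that by simp
      also have "norm \<dots> \<le> norm ((w - z) - (proj w - proj z))"
        by (rule Finite_Cartesian_Product.norm_nth_le)
      also have "\<dots> \<le> norm (w - z) + norm (proj w - proj z)"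
        by (rule norm_triangle_ineq4)
      also have "\<dots> \<le> 2 * norm (w - z)" using proj_lipschitz[of w z] by simp
      finally show ?case by simp
    qed
  qed
qed

text \<open>The case in which \<open>lam\<close> may fail to converge: the rate comes from a factor
  \<open>c\<close> supplied by \<open>coeff_bigo\<close>, the smallness from
  \<open>d\<close>.\<close>

lemma small_lam_of_bound:
  assumes c: "c \<in> O[G](\<lambda>w. norm (w - z))" and d: "(d \<longlongrightarrow> 0) G"
    and bound: "\<forall>\<^sub>F w in G. \<bar>(lam (\<alpha> w) (\<beta> w) (\<rho> w) - \<kappa>) * (z \<bullet> N w)\<bar> \<le> \<bar>c w * d w\<bar>"
  shows "(\<lambda>w. (lam (\<alpha> w) (\<beta> w) (\<rho> w) - \<kappa>) * (z \<bullet> N w)) \<in> o[G](\<lambda>w. norm (w - z))"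
proof -
  have "d \<in> o[G](\<lambda>_. 1 :: real)"
    using d by (intro smalloI_tendsto) auto
  from landau_o.big_small_mult[OF c this] have *: "(\<lambda>w. c w * d w) \<in> o[G](\<lambda>w. norm (w - z))" by simp
  have "(\<lambda>w. (lam (\<alpha> w) (\<beta> w) (\<rho> w) - \<kappa>) * (z \<bullet> N w)) \<in> O[G](\<lambda>w. c w * d w)"
    by (rule bigoI[of _ 1]) (use bound in simp)
  from landau_o.big_small_trans[OF this *] show ?thesis .
qed

text \<open>The product \<alpha> exp \<rho> converges, so \<alpha> \<rho> and \<alpha> tend to 0;
  likewise \<beta> (1 - \<rho>) converges, so \<beta> and \<beta> exp (-\<rho>) tend to 0. One
  component of each summand survives.\<close>

lemma at_top_limit_form:
  assumes "filterlim \<rho> at_top G" "G \<noteq> bot" "z \<noteq> 0"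
  obtains A B where "proj z = vector [0, 0, A]" "z - proj z = vector [0, - B, 0]" "A \<ge> 0" "B \<ge> 0" "A > 0 \<or> B > 0"
proof -
  note lim = tendsto_coeff
  note cmp = filterlim_compose[OF _ assms(1)]
  define A B where "A = proj z $ 3" and "B = - (z - proj z) $ 2"
  have "((\<lambda>r::real. r * exp (- r)) \<longlongrightarrow> 0) at_top" "((\<lambda>r::real. exp (- r)) \<longlongrightarrow> 0) at_top" 
    "((\<lambda>r::real. 1 / (1 - r)) \<longlongrightarrow> 0) at_top" by real_asymp+
  note l0 = this[THEN cmp]
  have "((\<lambda>w. (\<alpha> w * exp (\<rho> w)) * (\<rho> w * exp (- \<rho> w))) \<longlongrightarrow> A * 0) G"
    unfolding A_def by (intro tendsto_mult lim l0)
  moreover have "(\<alpha> w * exp (\<rho> w)) * (\<rho> w * exp (- \<rho> w)) = \<alpha> w * \<rho> w" for w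
    by (simp add: exp_minus)
  ultimately have f1: "proj z $ 1 = 0"
    using tendsto_unique[OF assms(2) lim(1)] by simp
  have "((\<lambda>w. (\<alpha> w * exp (\<rho> w)) * exp (- \<rho> w)) \<longlongrightarrow> A * 0) G"
    unfolding A_def by (intro tendsto_mult lim l0)
  moreover have "(\<alpha> w * exp (\<rho> w)) * exp (- \<rho> w) = \<alpha> w" for w
    by (simp add: exp_minus)
  ultimately have f2: "proj z $ 2 = 0"
    using tendsto_unique[OF assms(2) lim(2)] by simp
  have ev1: "\<forall>\<^sub>F w in G. \<rho> w > 1"
    using assms(1) by (simp add: filterlim_at_top_dense)
  have "((\<lambda>w. (\<beta> w * (1 - \<rho> w)) * (1 / (1 - \<rho> w))) \<longlongrightarrow> (z - proj z) $ 2 * 0) G"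
    by (intro tendsto_mult lim l0)
  then have "(\<beta> \<longlongrightarrow> (z - proj z) $ 2 * 0) G"
    by (rule Lim_transform_eventually) (use ev1 in \<open>eventually_elim, simp\<close>)
  then have g1: "(z - proj z) $ 1 = 0"
    using tendsto_unique[OF assms(2) lim(4)] by simp
  have "((\<lambda>w. \<beta> w * exp (- \<rho> w)) \<longlongrightarrow> (z - proj z) $ 1 * 0) G"
    by (intro tendsto_mult lim l0)
  then have g3: "(z - proj z) $ 3 = 0"
    using tendsto_unique[OF assms(2) lim(6)] by fastforce
  have A: "A \<ge> 0" unfolding A_def using exp_coneD(2)[OF proj_in] .
  have "\<forall>\<^sub>F w in G. \<beta> w * (1 - \<rho> w) \<le> 0"
    using ev1 pos_at by eventually_elim (simp add: mult_nonneg_nonpos)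
  from tendsto_upperbound[OF lim(5) this assms(2)] have B: "B \<ge> 0"
    by (simp add: B_def)
  have f: "proj z = vector [0, 0, A]" and g: "z - proj z = vector [0, - B, 0]"
    using f1 f2 g1 g3 by (simp_all add: vec_eq_iff forall_3 A_def B_def)
  have "z = vector [0, 0, A] + vector [0, - B, 0]"
    using f g by (metis add.commute diff_add_cancel)
  then have "A > 0 \<or> B > 0"
    using A B assms(3) by (auto simp: vec_eq_iff forall_3)
  then show thesis using that f g A B by blast
qed

text \<open>Convergence of \<beta> exp (-\<rho>) forces \<beta> and \<beta> (1 - \<rho>) to 0, and
  convergence of \<alpha> \<rho> forces \<alpha> and \<alpha> exp \<rho> to 0.\<close>

lemma at_bot_limit_form:
  assumes "filterlim \<rho> at_bot G" "G \<noteq> bot" "z \<noteq> 0"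
  obtains A B where "proj z = vector [- A, 0, 0]" "z - proj z = vector [0, 0, - B]" "A \<ge> 0" "B \<ge> 0" "A > 0 \<or> B > 0"
proof -
  note lim = tendsto_coeff
  note cmp = filterlim_compose[OF _ assms(1)]
  define A B where "A = - proj z $ 1" and "B = - (z - proj z) $ 3"
  have "((\<lambda>r::real. (1 - r) * exp r) \<longlongrightarrow> 0) at_bot" "((\<lambda>r::real. exp r) \<longlongrightarrow> 0) at_bot" 
    "((\<lambda>r::real. 1 / r) \<longlongrightarrow> 0) at_bot" by real_asymp+
  note l0 = this[THEN cmp]
  have ev1: "\<forall>\<^sub>F w in G. \<rho> w < 0"
    using assms(1) by (simp add: filterlim_at_bot_dense)
  have "((\<lambda>w. (\<beta> w * exp (- \<rho> w)) * ((1 - \<rho> w) * exp (\<rho> w))) \<longlongrightarrow> B * 0) G"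
    unfolding B_def using lim by (intro tendsto_mult l0) simp
  moreover have "(\<beta> w * exp (- \<rho> w)) * ((1 - \<rho> w) * exp (\<rho> w)) = \<beta> w * (1 - \<rho> w)" for w
    by (simp add: exp_minus)
  ultimately have g2: "(z - proj z) $ 2 = 0"
    using tendsto_unique[OF assms(2) lim(5)] by simp
  have "((\<lambda>w. (\<beta> w * exp (- \<rho> w)) * exp (\<rho> w)) \<longlongrightarrow> B * 0) G"
    unfolding B_def using lim by (intro tendsto_mult l0) simp
  moreover have "(\<beta> w * exp (- \<rho> w)) * exp (\<rho> w) = \<beta> w" for w
    by (simp add: exp_minus)
  ultimately have g1: "(z - proj z) $ 1 = 0"
    using tendsto_unique[OF assms(2) lim(4)] by simp
  have "((\<lambda>w. (\<alpha> w * \<rho> w) * (1 / \<rho> w)) \<longlongrightarrow> proj z $ 1 * 0) G"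
    by (intro tendsto_mult lim l0)
  then have "(\<alpha> \<longlongrightarrow> proj z $ 1 * 0) G"
    by (rule Lim_transform_eventually) (use ev1 in \<open>eventually_elim, simp\<close>)
  then have f2: "proj z $ 2 = 0"
    using tendsto_unique[OF assms(2) lim(2)] by simp
  have "((\<lambda>w. \<alpha> w * exp (\<rho> w)) \<longlongrightarrow> proj z $ 2 * 0) G"
    by (intro tendsto_mult lim l0)
  then have f3: "proj z $ 3 = 0"
    using tendsto_unique[OF assms(2) lim(3)] by fastforce
  have A: "A \<ge> 0" unfolding A_def using exp_coneD(3)[OF proj_in f2] by simp
  have "\<forall>\<^sub>F w in G. 0 \<le> \<beta> w * exp (- \<rho> w)"
    using pos_at by eventually_elim simp
  from tendsto_lowerbound[OF lim(6) this assms(2)] have B: "B \<ge> 0"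
    by (simp add: B_def)
  have f: "proj z = vector [- A, 0, 0]" and g: "z - proj z = vector [0, 0, - B]"
    using f2 f3 g1 g2 by (simp_all add: vec_eq_iff forall_3 A_def B_def)
  have "z = vector [- A, 0, 0] + vector [0, 0, - B]"
    using f g by (metis add.commute diff_add_cancel)
  then have "A > 0 \<or> B > 0"
    using A B assms(3) by (auto simp: vec_eq_iff forall_3)
  then show thesis using that f g A B by blast
qed

end

subsection \<open>Approaching a point through the curved region\<close>

lemma isCont_frame: "isCont pv r" "isCont qv r"
  using has_vector_derivative_continuous[OF pv_derivative] has_vector_derivative_continuous[OF qv_derivative]
  by blast+

lemma tendsto_pv: "(pv \<longlongrightarrow> pv r) (nhds r)" and tendsto_qv: "(qv \<longlongrightarrow> qv r) (nhds r)"
  using isCont_frame by (simp_all add: isCont_def tendsto_at_iff_tendsto_nhds)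

lemma tendsto_nv: "(nv \<longlongrightarrow> nv r) (nhds r)"
  by (rule tendsto_3; unfold nv_nth; intro tendsto_intros filterlim_ident)

lemma tendsto_rates:
  "((\<lambda>r. pv' r \<bullet> nv r) \<longlongrightarrow> pv' r \<bullet> nv r) (nhds r)" "((\<lambda>r. qv' r \<bullet> nv r) \<longlongrightarrow> qv' r \<bullet> nv r) (nhds r)"
  unfolding frame_derivatives by (intro tendsto_intros tendsto_pv tendsto_qv filterlim_ident)+

text \<open>Divide both functions by \<open>y - x\<close>. The filter is \<open>nhds x\<close>,
  since the parameter may take its limit value; there both functions vanish.\<close>

lemma smallo_of_derivative:
  fixes k h :: "real \<Rightarrow> real"
  assumes k: "(k has_real_derivative 0) (at x)" "k x = 0"
    and h: "(h has_real_derivative c) (at x)" "h x = 0" and "c \<noteq> 0"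
  shows "k \<in> o[nhds x](h)"
proof -
  have at: "k \<in> o[at x](h)"
  proof (rule smalloI_tendsto)
    have hx: "((\<lambda>y. h y / (y - x)) \<longlongrightarrow> c) (at x)" and kx: "((\<lambda>y. k y / (y - x)) \<longlongrightarrow> 0) (at x)"
      using h k by (simp_all add: has_field_derivative_iff)
    have "((\<lambda>y. (k y / (y - x)) / (h y / (y - x))) \<longlongrightarrow> 0 / c) (at x)"
      by (intro tendsto_divide hx kx assms)
    then have "((\<lambda>y. (k y / (y - x)) / (h y / (y - x))) \<longlongrightarrow> 0) (at x)"
      by simp
    then show "((\<lambda>y. k y / h y) \<longlongrightarrow> 0) (at x)"
      by (rule Lim_transform_eventually) (simp add: eventually_at_filter)
    have "\<forall>\<^sub>F y in at x. h y / (y - x) \<noteq> 0"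
      using tendsto_imp_eventually_ne[OF hx \<open>c \<noteq> 0\<close>] .
    then show "\<forall>\<^sub>F y in at x. h y \<noteq> 0"
      by eventually_elim auto
  qed
  show ?thesis
  proof (rule landau_o.smallI)
    fix e :: real assume "e > 0"
    from landau_o.smallD[OF at this] show "\<forall>\<^sub>F y in nhds x. norm (k y) \<le> e * norm (h y)"
      using k h by (simp add: eventually_nhds_conv_at)
  qed
qed

context curved_approach
begin

text \<open>For \<open>B > 0\<close> the bound on \<open>lam\<close> drives it to 0. For
  \<open>B = 0\<close> only the product of \<open>1 - lam\<close> with
  \<open>z \<bullet> N w\<close> is estimated, using that \<beta> (1 - \<rho>) is
  O(\<open>norm (w - z)\<close>).\<close>

lemma curved_limit_at_top:
  assumes top: "filterlim \<rho> at_top G" and "G \<noteq> bot" "z \<noteq> 0"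
  shows "\<exists>\<kappa>. curved_limit z \<alpha> \<beta> \<rho> at_top \<kappa> (vector [0, 0, 1]) (vector [-1, 0, 0])"
proof -
  obtain A B where AB: "proj z = vector [0, 0, A]" "z - proj z = vector [0, - B, 0]" "A \<ge> 0" "B \<ge> 0" "A > 0 \<or> B > 0"
    using at_top_limit_form[OF assms] .
  define \<kappa> :: real where "\<kappa> = (if B = 0 then 1 else 0)"
  have z: "proj z + (z - proj z) = z" by simp
  note small = small_frame_at_top[OF AB \<kappa>_def, unfolded z]
  note lim = tendsto_coeff[unfolded AB(2), unfolded AB(1), unfolded vector_3]
  have ev: "\<forall>\<^sub>F w in G. \<alpha> w > 0 \<and> \<beta> w > 0 \<and> \<rho> w > 1"
    using pos_at filterlim_at_top_dense[THEN iffD1, OF top, rule_format, of 1] by eventually_elim auto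
  have "(\<lambda>w. (lam (\<alpha> w) (\<beta> w) (\<rho> w) - \<kappa>) * (z \<bullet> N w)) \<in> o[G](\<lambda>w. norm (w - z))"
  proof (cases "B = 0")
    case False
    \<comment> \<open>What remains of the bound on \<open>lam\<close> after splitting off \<alpha>
      exp \<rho> and \<beta> (\<rho> - 1), whose quotient tends to A / B; it decays like r^3 exp
      (-r).\<close>
    define h where "h r = exp (- r) * (r - 1) * (pv' r \<bullet> nv r) / (qv' r \<bullet> nv r)" for r
    have "(h \<longlongrightarrow> 0) at_top"
      unfolding h_def frame_derivatives unfolding inner_3 pv_nth qv_nth by real_asymp
    from filterlim_compose[OF this top] have h: "((\<lambda>w. h (\<rho> w)) \<longlongrightarrow> 0) G" .
    have "((\<lambda>w. (\<alpha> w * exp (\<rho> w)) / (- (\<beta> w * (1 - \<rho> w))) * h (\<rho> w)) \<longlongrightarrow> A / (- (- B)) * 0) G"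
      by (intro tendsto_intros lim h) (use False in simp)
    then have up: "((\<lambda>w. (\<alpha> w * exp (\<rho> w)) / (- (\<beta> w * (1 - \<rho> w))) * h (\<rho> w)) \<longlongrightarrow> 0) G"
      by simp
    have "((\<lambda>w. lam (\<alpha> w) (\<beta> w) (\<rho> w)) \<longlongrightarrow> 0) G"
    proof (rule tendsto_sandwich[OF _ _ tendsto_const up])
      show "\<forall>\<^sub>F w in G. 0 \<le> lam (\<alpha> w) (\<beta> w) (\<rho> w)"
        using ev by eventually_elim (simp add: lam_bounds)
      show "\<forall>\<^sub>F w in G. lam (\<alpha> w) (\<beta> w) (\<rho> w) \<le> (\<alpha> w * exp (\<rho> w)) / (- (\<beta> w * (1 - \<rho> w))) * h (\<rho> w)"
        using ev
      proof eventually_elim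
        case (elim w)
        then have "lam (\<alpha> w) (\<beta> w) (\<rho> w) \<le> \<alpha> w * (pv' (\<rho> w) \<bullet> nv (\<rho> w)) / (\<beta> w * (qv' (\<rho> w) \<bullet> nv (\<rho> w)))"
          by (intro lam_bounds) auto
        also have "\<dots> = (\<alpha> w * exp (\<rho> w)) / (- (\<beta> w * (1 - \<rho> w))) * h (\<rho> w)"
          using elim frame_derivatives_pos[of "\<rho> w"] by (simp add: h_def exp_minus divide_simps) (simp add: algebra_simps)
        finally show ?case .
      qed
    qed
    then show ?thesis
      using False by (intro small_lam_of_tendsto) (simp add: \<kappa>_def)
  next
    case True
    then have A: "A > 0" using AB by simp
    have "z = vector [0, 0, A] + vector [0, - B, 0]"
      using AB(1,2) by (metis add.commute diff_add_cancel)
    then have z3: "z = vector [0, 0, A]"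
      using True by (simp add: vec_eq_iff forall_3)
    \<comment> \<open>The first factor grows like exp r / r^3, but
      \<open>z \<bullet> sgn (nv r)\<close> decays like r exp (-r), so the product is of order 1 /
      r^2.\<close>
    define h where "h r = exp r * (qv' r \<bullet> nv r) / ((r - 1) * (pv' r \<bullet> nv r)) * (z \<bullet> sgn (nv r))" for r
    have "(h \<longlongrightarrow> 0) at_top"
      unfolding h_def frame_derivatives z3 using A by (simp add: inner_3 frame_unfold) real_asymp
    from filterlim_compose[OF this top] have h: "((\<lambda>w. h (\<rho> w)) \<longlongrightarrow> 0) G" .
    show ?thesis
    proof (rule small_lam_of_bound)
      show "(\<lambda>w. \<beta> w * qv (\<rho> w) $ 2) \<in> O[G](\<lambda>w. norm (w - z))"
        using True by (intro coeff_bigo) (subst AB(2), simp)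
      have "((\<lambda>w. h (\<rho> w) / (\<alpha> w * exp (\<rho> w))) \<longlongrightarrow> 0 / A) G"
        by (intro tendsto_intros lim h) (use A in simp)
      then show "((\<lambda>w. h (\<rho> w) / (\<alpha> w * exp (\<rho> w))) \<longlongrightarrow> 0) G"
        by simp
      show "\<forall>\<^sub>F w in G. \<bar>(lam (\<alpha> w) (\<beta> w) (\<rho> w) - \<kappa>) * (z \<bullet> N w)\<bar> \<le> \<bar>\<beta> w * qv (\<rho> w) $ 2 * (h (\<rho> w) / (\<alpha> w * exp (\<rho> w)))\<bar>"
        using ev
      proof eventually_elim
        case (elim w)
        have "\<bar>lam (\<alpha> w) (\<beta> w) (\<rho> w) - \<kappa>\<bar> \<le> \<beta> w * (qv' (\<rho> w) \<bullet> nv (\<rho> w)) / (\<alpha> w * (pv' (\<rho> w) \<bullet> nv (\<rho> w)))"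
          using lam_bounds(2,4)[of "\<alpha> w" "\<beta> w" "\<rho> w"] elim True by (simp add: \<kappa>_def)
        then have "\<bar>(lam (\<alpha> w) (\<beta> w) (\<rho> w) - \<kappa>) * (z \<bullet> N w)\<bar> \<le>
            \<bar>\<beta> w * (qv' (\<rho> w) \<bullet> nv (\<rho> w)) / (\<alpha> w * (pv' (\<rho> w) \<bullet> nv (\<rho> w))) * (z \<bullet> N w)\<bar>"
          unfolding abs_mult[of _ "z \<bullet> N w"] by (rule mult_right_mono[OF order_trans[OF _ abs_ge_self]]) simp_all
        also have "\<beta> w * (qv' (\<rho> w) \<bullet> nv (\<rho> w)) / (\<alpha> w * (pv' (\<rho> w) \<bullet> nv (\<rho> w))) * (z \<bullet> N w) =
            - (\<beta> w * qv (\<rho> w) $ 2 * (h (\<rho> w) / (\<alpha> w * exp (\<rho> w))))"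
          using elim frame_derivatives_pos[of "\<rho> w"] by (simp add: h_def divide_simps) (simp add: algebra_simps)
        finally show ?case by simp
      qed
    qed
  qed
  then have "curved_limit z \<alpha> \<beta> \<rho> at_top \<kappa> (vector [0, 0, 1]) (vector [-1, 0, 0])"
    using top small lim_frame_at_top by unfold_locales
  then show ?thesis ..
qed

text \<open>As at \<infinity> with the two summands exchanged: for \<open>A > 0\<close> the bound on
  \<open>1 - lam\<close> drives \<open>lam\<close> to 1, and for \<open>A = 0\<close> the rate comes
  from \<alpha> \<rho>.\<close>

lemma curved_limit_at_bot:
  assumes bot: "filterlim \<rho> at_bot G" and "G \<noteq> bot" "z \<noteq> 0"
  shows "\<exists>\<kappa>. curved_limit z \<alpha> \<beta> \<rho> at_bot \<kappa> (vector [-1, 0, 0]) (vector [0, 1, 0])"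
proof -
  obtain A B where AB: "proj z = vector [- A, 0, 0]" "z - proj z = vector [0, 0, - B]" "A \<ge> 0" "B \<ge> 0" "A > 0 \<or> B > 0"
    using at_bot_limit_form[OF assms] .
  define \<kappa> :: real where "\<kappa> = (if A = 0 then 0 else 1)"
  have z: "proj z + (z - proj z) = z" by simp
  note small = small_frame_at_bot[OF AB \<kappa>_def, unfolded z]
  note lim = tendsto_coeff[unfolded AB(2), unfolded AB(1), unfolded vector_3]
  have ev: "\<forall>\<^sub>F w in G. \<alpha> w > 0 \<and> \<beta> w > 0 \<and> \<rho> w < 0"
    using pos_at filterlim_at_bot_dense[THEN iffD1, OF bot, rule_format, of 0] by eventually_elim auto
  have "(\<lambda>w. (lam (\<alpha> w) (\<beta> w) (\<rho> w) - \<kappa>) * (z \<bullet> N w)) \<in> o[G](\<lambda>w. norm (w - z))"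
  proof (cases "A = 0")
    case False
    define h where "h r = exp r * (- r) * (qv' r \<bullet> nv r) / (pv' r \<bullet> nv r)" for r
    have "(h \<longlongrightarrow> 0) at_bot"
      unfolding h_def frame_derivatives unfolding inner_3 pv_nth qv_nth by real_asymp
    from filterlim_compose[OF this bot] have h: "((\<lambda>w. h (\<rho> w)) \<longlongrightarrow> 0) G" .
    have "((\<lambda>w. 1 - (\<beta> w * exp (- \<rho> w)) / (- (\<alpha> w * \<rho> w)) * h (\<rho> w)) \<longlongrightarrow> 1 - (- (- B)) / (- (- A)) * 0) G"
      by (intro tendsto_intros lim h) (use False in simp)
    then have lo: "((\<lambda>w. 1 - (\<beta> w * exp (- \<rho> w)) / (- (\<alpha> w * \<rho> w)) * h (\<rho> w)) \<longlongrightarrow> 1) G"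
      by simp
    have "((\<lambda>w. lam (\<alpha> w) (\<beta> w) (\<rho> w)) \<longlongrightarrow> 1) G"
    proof (rule tendsto_sandwich[OF _ _ lo tendsto_const])
      show "\<forall>\<^sub>F w in G. lam (\<alpha> w) (\<beta> w) (\<rho> w) \<le> 1"
        using ev by eventually_elim (simp add: lam_bounds)
      show "\<forall>\<^sub>F w in G. 1 - (\<beta> w * exp (- \<rho> w)) / (- (\<alpha> w * \<rho> w)) * h (\<rho> w) \<le> lam (\<alpha> w) (\<beta> w) (\<rho> w)"
        using ev
      proof eventually_elim
        case (elim w)
        then have "1 - lam (\<alpha> w) (\<beta> w) (\<rho> w) \<le> \<beta> w * (qv' (\<rho> w) \<bullet> nv (\<rho> w)) / (\<alpha> w * (pv' (\<rho> w) \<bullet> nv (\<rho> w)))"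
          by (intro lam_bounds) auto
        also have "\<dots> = (\<beta> w * exp (- \<rho> w)) / (- (\<alpha> w * \<rho> w)) * h (\<rho> w)"
          using elim frame_derivatives_pos[of "\<rho> w"] by (simp add: h_def exp_minus divide_simps)
        finally show ?case by simp
      qed
    qed
    then show ?thesis
      using False by (intro small_lam_of_tendsto) (simp add: \<kappa>_def)
  next
    case True
    then have B: "B > 0" using AB by simp
    have "z = vector [- A, 0, 0] + vector [0, 0, - B]"
      using AB(1,2) by (metis add.commute diff_add_cancel)
    then have z3: "z = vector [0, 0, - B]"
      using True by (simp add: vec_eq_iff forall_3)
    define h where "h r = exp (- r) * (pv' r \<bullet> nv r) / (r * (qv' r \<bullet> nv r)) * (z \<bullet> sgn (nv r))" for r
    have "(h \<longlongrightarrow> 0) at_bot"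
      unfolding h_def frame_derivatives z3 using B by (simp add: inner_3 frame_unfold) real_asymp
    from filterlim_compose[OF this bot] have h: "((\<lambda>w. h (\<rho> w)) \<longlongrightarrow> 0) G" .
    show ?thesis
    proof (rule small_lam_of_bound)
      show "(\<lambda>w. \<alpha> w * pv (\<rho> w) $ 1) \<in> O[G](\<lambda>w. norm (w - z))"
        using True by (intro coeff_bigo) (simp only: AB vector_3)
      have "((\<lambda>w. h (\<rho> w) / (\<beta> w * exp (- \<rho> w))) \<longlongrightarrow> 0 / (- (- B))) G"
        by (intro tendsto_intros lim h) (use B in simp)
      then show "((\<lambda>w. h (\<rho> w) / (\<beta> w * exp (- \<rho> w))) \<longlongrightarrow> 0) G"
        by simp
      show "\<forall>\<^sub>F w in G. \<bar>(lam (\<alpha> w) (\<beta> w) (\<rho> w) - \<kappa>) * (z \<bullet> N w)\<bar> \<le> \<bar>\<alpha> w * pv (\<rho> w) $ 1 * (h (\<rho> w) / (\<beta> w * exp (- \<rho> w)))\<bar>"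
        using ev
      proof eventually_elim
        case (elim w)
        have "\<bar>lam (\<alpha> w) (\<beta> w) (\<rho> w) - \<kappa>\<bar> \<le> \<alpha> w * (pv' (\<rho> w) \<bullet> nv (\<rho> w)) / (\<beta> w * (qv' (\<rho> w) \<bullet> nv (\<rho> w)))"
          using lam_bounds(1,3)[of "\<alpha> w" "\<beta> w" "\<rho> w"] elim True by (simp add: \<kappa>_def)
        then have "\<bar>(lam (\<alpha> w) (\<beta> w) (\<rho> w) - \<kappa>) * (z \<bullet> N w)\<bar> \<le>
            \<bar>\<alpha> w * (pv' (\<rho> w) \<bullet> nv (\<rho> w)) / (\<beta> w * (qv' (\<rho> w) \<bullet> nv (\<rho> w))) * (z \<bullet> N w)\<bar>"
          unfolding abs_mult[of _ "z \<bullet> N w"] by (rule mult_right_mono[OF order_trans[OF _ abs_ge_self]]) simp_all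
        also have "\<alpha> w * (pv' (\<rho> w) \<bullet> nv (\<rho> w)) / (\<beta> w * (qv' (\<rho> w) \<bullet> nv (\<rho> w))) * (z \<bullet> N w) =
            \<alpha> w * pv (\<rho> w) $ 1 * (h (\<rho> w) / (\<beta> w * exp (- \<rho> w)))"
          using elim frame_derivatives_pos[of "\<rho> w"] by (simp add: h_def divide_simps)
        finally show ?case by simp
      qed
    qed
  qed
  then have "curved_limit z \<alpha> \<beta> \<rho> at_bot \<kappa> (vector [-1, 0, 0]) (vector [0, 1, 0])"
    using bot small lim_frame_at_bot by unfold_locales
  then show ?thesis ..
qed

text \<open>At a finite limit, \<open>proj z\<close> and \<open>z - proj z\<close> are multiples of
  \<open>pv r\<close> and \<open>qv r\<close>, not both zero. Then \<open>z \<bullet> nv s\<close>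
  has a simple zero at \<open>r\<close>, while the three functions to be compared with it have zero
  derivative there.\<close>

lemma curved_limit_at:
  assumes lim_r: "(\<rho> \<longlongrightarrow> r) G" and "G \<noteq> bot" "z \<noteq> 0"
  shows "\<exists>\<kappa>. curved_limit z \<alpha> \<beta> \<rho> (nhds r) \<kappa> (sgn (pv r)) (sgn (nv r))"
proof -
  define a b where "a = proj z $ 2" and "b = (z - proj z) $ 1"
  have lim: "(\<alpha> \<longlongrightarrow> a) G" "(\<beta> \<longlongrightarrow> b) G"
    unfolding a_def b_def by (fact tendsto_coeff)+
  have f: "proj z = a *\<^sub>R pv r"
    using tendsto_frame(1) by (rule tendsto_unique[OF assms(2)])
      (intro tendsto_intros lim filterlim_compose[OF tendsto_pv lim_r])
  have g: "z - proj z = b *\<^sub>R qv r"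
    using tendsto_frame(2) by (rule tendsto_unique[OF assms(2)])
      (intro tendsto_intros lim filterlim_compose[OF tendsto_qv lim_r])
  have z: "z = a *\<^sub>R pv r + b *\<^sub>R qv r"
    using f g by (metis add.commute diff_add_cancel)
  have "\<forall>\<^sub>F w in G. 0 \<le> \<alpha> w" "\<forall>\<^sub>F w in G. 0 \<le> \<beta> w"
    using pos_at by (auto elim: eventually_mono)
  then have "0 \<le> a" "0 \<le> b"
    using lim assms(2) by (auto intro: tendsto_lowerbound)
  moreover have "a \<noteq> 0 \<or> b \<noteq> 0" using z assms(3) by auto
  ultimately have c: "a * (pv' r \<bullet> nv r) + b * (qv' r \<bullet> nv r) > 0"
    using frame_derivatives_pos[of r] by (auto intro: add_pos_nonneg add_nonneg_pos)
  define \<kappa> where "\<kappa> = lam a b r"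
  have "((\<lambda>w. lam (\<alpha> w) (\<beta> w) (\<rho> w)) \<longlongrightarrow> \<kappa>) G"
    unfolding \<kappa>_def lam_def using c
    by (intro tendsto_intros lim filterlim_compose[OF tendsto_rates(1) lim_r] filterlim_compose[OF tendsto_rates(2) lim_r]) simp
  from small_lam_of_tendsto[OF this] have small: "(\<lambda>w. (lam (\<alpha> w) (\<beta> w) (\<rho> w) - \<kappa>) * (z \<bullet> N w)) \<in> o[G](\<lambda>w. norm (w - z))" .
  define X Y where "X = pv' r \<bullet> nv r" and "Y = qv' r \<bullet> nv r"
  have e: "exp (- r) * exp r = 1" by simp
  \<comment> \<open>The value is the one obtained by differentiating
    \<open>pv s \<bullet> nv s = 0\<close>; similarly for \<open>qv\<close>.\<close>
  have dp: "((\<lambda>s. pv r \<bullet> nv s) has_real_derivative - X) (at r)"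
    unfolding X_def frame_derivatives unfolding inner_3 pv_nth qv_nth nv_nth
    by (rule derivative_eq_intros refl)+ (simp add: power2_eq_square, use e in algebra)
  have dq: "((\<lambda>s. qv r \<bullet> nv s) has_real_derivative - Y) (at r)"
    unfolding Y_def frame_derivatives unfolding inner_3 pv_nth qv_nth nv_nth
    by (rule derivative_eq_intros refl)+ (simp add: power2_eq_square, use e in algebra)
  have dz: "((\<lambda>s. z \<bullet> nv s) has_real_derivative - (a * X + b * Y)) (at r)"
    unfolding z inner_add_left inner_scaleR_left
    by (rule derivative_eq_intros dp dq refl)+ simp
  have zr: "z \<bullet> nv r = 0" by (simp add: z inner_add_left)
  have nz: "- (a * X + b * Y) \<noteq> 0" using c by (simp add: X_def Y_def)
  note sm = smallo_of_derivative[OF _ _ dz zr nz]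
  have s1: "(\<lambda>s. (z - proj z) \<bullet> pv s) \<in> o[nhds r](\<lambda>s. z \<bullet> nv s)"
  proof (rule sm)
    show "((\<lambda>s. (z - proj z) \<bullet> pv s) has_real_derivative 0) (at r)"
      unfolding g inner_3 pv_nth vector_scaleR_component qv_nth
      by (auto intro!: derivative_eq_intros)
  qed (simp add: g)
  have s2: "(\<lambda>s. proj z \<bullet> qv s) \<in> o[nhds r](\<lambda>s. z \<bullet> nv s)"
  proof (rule sm)
    show "((\<lambda>s. proj z \<bullet> qv s) has_real_derivative 0) (at r)"
      unfolding f inner_3 pv_nth vector_scaleR_component qv_nth
      by (auto intro!: derivative_eq_intros)
  qed (simp add: f)
  have s3: "(\<lambda>s. proj z \<bullet> nv s - \<kappa> * (z \<bullet> nv s)) \<in> o[nhds r](\<lambda>s. z \<bullet> nv s)"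
  proof (rule sm)
    \<comment> \<open>The choice of \<open>\<kappa>\<close> is exactly what cancels the first-order
      terms.\<close>
    have "\<kappa> * (a * X + b * Y) = a * X"
      using nz by (simp add: \<kappa>_def lam_def X_def Y_def)
    then have "a * - X - \<kappa> * - (a * X + b * Y) = 0"
      by (simp only: mult_minus_right)
    then show "((\<lambda>s. proj z \<bullet> nv s - \<kappa> * (z \<bullet> nv s)) has_real_derivative 0) (at r)"
      unfolding f inner_scaleR_left by (rule DERIV_cong[rotated]) (intro DERIV_diff DERIV_cmult dp dz)
  qed (simp add: f zr)
  have norms: "((\<lambda>s. norm (pv s)) \<longlongrightarrow> norm (pv r)) (nhds r)" "((\<lambda>s. norm (qv s)) \<longlongrightarrow> norm (qv r)) (nhds r)"
    by (intro tendsto_norm tendsto_pv tendsto_qv)+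
  \<comment> \<open>Passing to unit vectors changes the comparison by the factor
    \<open>norm (nv s) / norm (pv s)\<close>, which is \<open>norm (qv s)\<close> and stays bounded
    near \<open>r\<close>.\<close>
  have "(\<lambda>s. 1 / norm (pv s)) \<in> O[nhds r](\<lambda>s. 1 / norm (nv s))"
    by (rule bigoI_tendsto[where c = "norm (qv r)"]) (use norms in \<open>simp_all add: norm_nv\<close>)
  from landau_o.small_big_mult[OF s1 this]
  have t1: "(\<lambda>s. (z - proj z) \<bullet> sgn (pv s)) \<in> o[nhds r](\<lambda>s. z \<bullet> sgn (nv s))"
    by (simp add: sgn_div_norm divide_inverse mult.commute)
  have "(\<lambda>s. 1 / norm (qv s)) \<in> O[nhds r](\<lambda>s. 1 / norm (nv s))"
    by (rule bigoI_tendsto[where c = "norm (pv r)"]) (use norms in \<open>simp_all add: norm_nv\<close>)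
  from landau_o.small_big_mult[OF s2 this]
  have t2: "(\<lambda>s. proj z \<bullet> sgn (qv s)) \<in> o[nhds r](\<lambda>s. z \<bullet> sgn (nv s))"
    by (simp add: sgn_div_norm divide_inverse mult.commute)
  from landau_o.small_big_mult[OF s3 landau_o.big_refl[of "\<lambda>s. 1 / norm (nv s)"]]
  have t3: "(\<lambda>s. proj z \<bullet> sgn (nv s) - \<kappa> * (z \<bullet> sgn (nv s))) \<in> o[nhds r](\<lambda>s. z \<bullet> sgn (nv s))"
    by (simp add: sgn_div_norm divide_inverse algebra_simps)
  have "curved_limit z \<alpha> \<beta> \<rho> (nhds r) \<kappa> (sgn (pv r)) (sgn (nv r))"
    by unfold_locales (intro lim_r small t1 t2 t3 tendsto_sgn tendsto_pv tendsto_nv pv_nz nv_nz)+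
  then show ?thesis ..
qed

text \<open>One of \<rho>, 1 - \<rho>, exp \<rho>, exp (-\<rho>) is written as a component of
  \<alpha> p or \<beta> q divided by \<alpha> or \<beta>. As \<open>z\<close> is nonzero, some such
  quotient has a limit, finite or infinite.\<close>

lemma direction_limits:
  assumes "G \<noteq> bot" "z \<noteq> 0"
  shows "(\<exists>r. (\<rho> \<longlongrightarrow> r) G) \<or> filterlim \<rho> at_top G \<or> filterlim \<rho> at_bot G"
proof -
  define f g where "f = proj z" and "g = z - proj z"
  note lim = tendsto_coeff[folded g_def, folded f_def]
  have pa: "\<forall>\<^sub>F w in G. \<alpha> w > 0" and pb: "\<forall>\<^sub>F w in G. \<beta> w > 0"
    using pos_at by (auto elim: eventually_mono)
  have fin: "f \<in> exp_cone" by (simp add: f_def proj_in)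
  have "pv r \<bullet> g \<le> 0" for r
    using proj_normal[OF pv_in_exp_cone, of z r] by (simp add: g_def inner_commute)
  note sg = normal_signs[OF this]
  have inv0: "filterlim (\<lambda>w. inverse (k w)) at_top G" if "(k \<longlongrightarrow> 0) G" "\<forall>\<^sub>F w in G. k w > 0" for k :: "real ^ 3 \<Rightarrow> real"
    using that by (intro filterlim_inverse_at_top) auto
  have top: "filterlim \<rho> at_top G" if "filterlim (\<lambda>w. exp (\<rho> w)) at_top G"
  proof -
    have "filterlim (\<lambda>w. ln (exp (\<rho> w))) at_top G"
      by (rule filterlim_compose[OF ln_at_top that])
    then show ?thesis by simp
  qed
  have bot: "filterlim \<rho> at_bot G" if "filterlim (\<lambda>w. exp (- \<rho> w)) at_top G"
  proof -
    have "filterlim (\<lambda>w. ln (exp (- \<rho> w))) at_top G"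
      by (rule filterlim_compose[OF ln_at_top that])
    then show ?thesis by (simp add: filterlim_uminus_at_top)
  qed
  \<comment> \<open>A positive limit of \<alpha> or \<beta> makes \<rho> converge; if that limit is
    0, another nonzero component makes \<rho> diverge with a definite sign.\<close>
  consider "f$2 > 0" | "f$2 = 0" "f$3 > 0" | "f$2 = 0" "f$1 < 0" | "g$1 > 0" | "g$1 = 0" "g$3 < 0" | "g$1 = 0" "g$2 < 0"
  proof -
    have "f \<noteq> 0 \<or> g \<noteq> 0" using assms(2) by (auto simp: f_def g_def)
    then show thesis
      using that exp_coneD[OF fin] sg by (auto simp: vec_eq_iff forall_3 less_le)
  qed
  then show ?thesis
  proof cases
    case 1
    have "((\<lambda>w. \<alpha> w * \<rho> w / \<alpha> w) \<longlongrightarrow> f$1 / f$2) G"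
      using 1 by (intro tendsto_divide lim) simp
    then have "(\<rho> \<longlongrightarrow> f$1 / f$2) G"
      by (rule Lim_transform_eventually) (use pa in \<open>eventually_elim, simp\<close>)
    then show ?thesis by blast
  next
    case 2
    have "filterlim (\<lambda>w. \<alpha> w * exp (\<rho> w) * inverse (\<alpha> w)) at_top G"
      using 2 lim(2) by (intro filterlim_tendsto_pos_mult_at_top[OF lim(3)] inv0 pa) auto
    then have "filterlim (\<lambda>w. exp (\<rho> w)) at_top G"
      by (rule filterlim_cong[THEN iffD1, rotated -1, OF _ refl refl]) (use pa in \<open>eventually_elim, simp\<close>)
    then show ?thesis using top by blast
  next
    case 3
    have "filterlim (\<lambda>w. \<alpha> w * \<rho> w * inverse (\<alpha> w)) at_bot G"
      using 3 lim(2) by (intro filterlim_tendsto_neg_mult_at_bot[OF lim(1)] inv0 pa) auto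
    then have "filterlim \<rho> at_bot G"
      by (rule filterlim_cong[THEN iffD1, rotated -1, OF _ refl refl]) (use pa in \<open>eventually_elim, simp\<close>)
    then show ?thesis by blast
  next
    case 4
    have "((\<lambda>w. 1 - \<beta> w * (1 - \<rho> w) / \<beta> w) \<longlongrightarrow> 1 - g$2 / g$1) G"
      using 4 by (intro tendsto_intros lim) simp
    then have "(\<rho> \<longlongrightarrow> 1 - g$2 / g$1) G"
      by (rule Lim_transform_eventually) (use pb in \<open>eventually_elim, simp\<close>)
    then show ?thesis by blast
  next
    case 5
    have "filterlim (\<lambda>w. \<beta> w * exp (- \<rho> w) * inverse (\<beta> w)) at_top G"
      using 5 lim(4) by (intro filterlim_tendsto_pos_mult_at_top[OF lim(6)] inv0 pb) auto
    then have "filterlim (\<lambda>w. exp (- \<rho> w)) at_top G"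
      by (rule filterlim_cong[THEN iffD1, rotated -1, OF _ refl refl]) (use pb in \<open>eventually_elim, simp\<close>)
    then show ?thesis using bot by blast
  next
    case 6
    have "filterlim (\<lambda>w. \<beta> w * (1 - \<rho> w) * inverse (\<beta> w)) at_bot G"
      using 6 lim(4) by (intro filterlim_tendsto_neg_mult_at_bot[OF lim(5)] inv0 pb) auto
    then have "filterlim (\<lambda>w. 1 - \<rho> w) at_bot G"
      by (rule filterlim_cong[THEN iffD1, rotated -1, OF _ refl refl]) (use pb in \<open>eventually_elim, simp\<close>)
    then have "filterlim (\<lambda>w. -1 + \<rho> w) at_top G"
      by (simp add: filterlim_uminus_at_bot)
    then have "filterlim \<rho> at_top G"
      using filterlim_tendsto_add_at_top[OF tendsto_const[of 1]] by fastforce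
    then show ?thesis by blast
  qed
qed

lemma curved_limit_exists:
  assumes "z \<noteq> 0"
  shows "\<exists>\<Phi> \<kappa> P0 N0. curved_limit z \<alpha> \<beta> \<rho> \<Phi> \<kappa> P0 N0"
proof (cases "G = bot")
  case True
  \<comment> \<open>If the curved region does not accumulate at \<open>z\<close>, every limit
    condition holds vacuously along \<open>bot\<close>.\<close>
  have "curved_limit z \<alpha> \<beta> \<rho> bot 0 0 0"
    by unfold_locales (simp_all add: True filterlim_def filtermap_bot)
  then show ?thesis by blast
next
  case False
  then show ?thesis
    using direction_limits[OF False assms] curved_limit_at[OF _ False assms]
      curved_limit_at_top[OF _ False assms] curved_limit_at_bot[OF _ False assms] by blast
qed

end

subsection \<open>Semismoothness\<close>

lemma proj_scaleR:
  assumes "t \<ge> 0"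
  shows "proj (t *\<^sub>R v) = t *\<^sub>R proj v"
proof (rule proj_eqI)
  have *: "t *\<^sub>R v - t *\<^sub>R proj v = t *\<^sub>R (v - proj v)" by (simp add: scaleR_diff_right)
  show "t *\<^sub>R proj v \<in> exp_cone" by (intro exp_cone_scaleR proj_in assms)
  show "(t *\<^sub>R v - t *\<^sub>R proj v) \<bullet> (t *\<^sub>R proj v) = 0"
    unfolding * by (simp add: proj_orth)
  show "(t *\<^sub>R v - t *\<^sub>R proj v) \<bullet> x \<le> 0" if "x \<in> exp_cone" for x
    unfolding * using proj_normal[OF that, of v] assms by (simp add: mult_nonneg_nonpos)
qed

lemma proj_0: "proj 0 = 0"
  using proj_scaleR[of 0 0] by simp

text \<open>The interior point makes a derivative equal to \<open>L\<close> even at boundary points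
  of \<open>A\<close>; closedness and convexity put the initial segment of a ray into
  \<open>A\<close> as soon as the ray meets \<open>A\<close> at arbitrarily small times.\<close>

definition linear_piece :: "(real ^ 3) set \<Rightarrow> (real ^ 3 \<Rightarrow> real ^ 3) \<Rightarrow> bool"
  where "linear_piece A L \<longleftrightarrow> closed A \<and> convex A \<and> interior A \<noteq> {} \<and> bounded_linear L \<and> (\<forall>x\<in>A. proj x = L x)"

lemma interiorI_box:
  fixes A :: "(real ^ 3) set"
  assumes "e > 0" "\<And>v. \<bar>v$1 - x\<bar> < e \<Longrightarrow> \<bar>v$2 - y\<bar> < e \<Longrightarrow> \<bar>v$3 - z\<bar> < e \<Longrightarrow> v \<in> A"
  shows "interior A \<noteq> {}"
proof -
  define c :: "real ^ 3" where "c = vector [x, y, z]"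
  have "ball c e \<subseteq> A"
  proof
    fix v assume "v \<in> ball c e"
    then have "norm (v - c) < e" by (simp add: dist_norm norm_minus_commute)
    then have "\<bar>(v - c) $ i\<bar> < e" for i
      using component_le_norm_cart[of "v - c" i] by linarith
    from this[of 1] this[of 2] this[of 3] show "v \<in> A"
      using assms(2)[of v] by (simp add: c_def)
  qed
  then have "c \<in> interior A" using \<open>e > 0\<close> by (auto simp: mem_interior)
  then show ?thesis by blast
qed

lemma linear_piece_exp_cone: "linear_piece exp_cone (\<lambda>v. v)"
proof -
  have "interior exp_cone \<noteq> {}"
  proof (rule interiorI_box[where e = "1/10" and x = "-1" and y = "1" and z = "2"])
    fix v :: "real ^ 3"
    assume "\<bar>v$1 - (-1)\<bar> < 1/10" "\<bar>v$2 - 1\<bar> < 1/10" "\<bar>v$3 - 2\<bar> < 1/10"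
    then have v: "v$1 \<le> 0" "9/10 \<le> v$2" "v$2 \<le> 11/10" "19/10 \<le> v$3"
      by linarith+
    \<comment> \<open>For \<open>r \<le> 1\<close> this follows from
      \<open>1 - r \<le> exp (- r)\<close>, since \<open>v$2 \<le> v$3\<close> in the box; beyond 1
      the left side is nonpositive.\<close>
    have "v$1 + (1 - r) * v$2 \<le> exp (- r) * v$3" for r
    proof (cases "r \<le> 1")
      case True
      have "(1 - r) * v$2 \<le> (1 - r) * v$3" using True v by (intro mult_left_mono) auto
      also have "\<dots> \<le> exp (- r) * v$3" using exp_ge_add_one_self[of "- r"] v by (intro mult_right_mono) auto
      finally show ?thesis using v by simp
    next
      case False
      then have "(1 - r) * v$2 \<le> 0" using v by (intro mult_nonpos_nonneg) auto
      moreover have "0 \<le> exp (- r) * v$3" using v by simp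
      ultimately show ?thesis using v by linarith
    qed
    then show "v \<in> exp_cone" by (simp add: exp_cone_eq inner_3)
  qed simp
  then show ?thesis
    by (simp add: linear_piece_def closed_exp_cone convex_exp_cone closest_point_self bounded_linear_ident)
qed

lemma linear_piece_polar_cone: "linear_piece polar_cone (\<lambda>v. 0)"
proof -
  have "interior polar_cone \<noteq> {}"
  proof (rule interiorI_box[where e = "1/10" and x = "1" and y = "-1" and z = "-2"])
    fix v :: "real ^ 3"
    assume "\<bar>v$1 - 1\<bar> < 1/10" "\<bar>v$2 - (-1)\<bar> < 1/10" "\<bar>v$3 - (-2)\<bar> < 1/10"
    then have v: "0 \<le> v$1" "v$1 \<le> 11/10" "v$2 \<le> 0" "v$3 \<le> - (19/10)"
      by linarith+
    have "r * v$1 + v$2 + exp r * v$3 \<le> 0" for r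
    proof (cases "r \<ge> 0")
      case True
      have "r \<le> exp r" using exp_ge_add_one_self[of r] by linarith
      then have "r * v$1 \<le> exp r * (- v$3)" using True v by (intro mult_mono) auto
      then show ?thesis using v by simp
    next
      case False
      then have "r * v$1 \<le> 0" using v by (intro mult_nonpos_nonneg) auto
      moreover have "exp r * v$3 \<le> 0" using v by (simp add: mult_nonneg_nonpos)
      ultimately show ?thesis using v by linarith
    qed
    then show "v \<in> polar_cone" by (simp add: polar_cone_def inner_3)
  qed simp
  moreover have "closed polar_cone"
    unfolding polar_cone_def Collect_all_eq by (intro closed_INT ballI closed_halfspace_le)
  moreover have "convex polar_cone"
    unfolding polar_cone_def Collect_all_eq by (intro convex_INT convex_halfspace_le)
  ultimately show ?thesis
    by (simp add: linear_piece_def proj_polar_cone bounded_linear_zero)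
qed

lemma linear_piece_quad:
  "linear_piece quad_up (\<lambda>v. vector [v$1, 0, v$3])" "linear_piece quad_dn (\<lambda>v. vector [v$1, 0, 0])"
proof -
  have bl: "bounded_linear (\<lambda>v :: real ^ 3. vector [v$1, 0, v$3] :: real ^ 3)"
    "bounded_linear (\<lambda>v :: real ^ 3. vector [v$1, 0, 0] :: real ^ 3)"
    unfolding linear_conv_bounded_linear[symmetric]
    by (auto intro!: linearI simp: vec_eq_iff forall_3)
  have cl: "closed quad_up" "closed quad_dn"
    unfolding quad_up_def quad_dn_def
    by (intro closed_Collect_conj closed_Collect_le continuous_intros)+
  have cv: "convex quad_up" "convex quad_dn"
    unfolding quad_up_def quad_dn_def
    by (auto intro!: convexI add_nonpos_nonpos mult_nonneg_nonpos)
  have "interior quad_up \<noteq> {}"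
    by (rule interiorI_box[where e = 1 and x = "-1" and y = "-1" and z = "1"]) (auto simp: quad_up_def)
  moreover have "interior quad_dn \<noteq> {}"
    by (rule interiorI_box[where e = 1 and x = "-1" and y = "-1" and z = "-1"]) (auto simp: quad_dn_def)
  ultimately show "linear_piece quad_up (\<lambda>v. vector [v$1, 0, v$3])" "linear_piece quad_dn (\<lambda>v. vector [v$1, 0, 0])"
    using bl cl cv by (simp_all add: linear_piece_def proj_quad_up proj_quad_dn)
qed

text \<open>Quantifying over \<open>D\<close> makes the condition vacuous where \<open>proj\<close>
  is not differentiable, in line with the sequences that define the generalized Jacobian.\<close>

definition small_error :: "real ^ 3 \<Rightarrow> real \<Rightarrow> real ^ 3 \<Rightarrow> bool"
  where "small_error z \<epsilon> w \<longleftrightarrow>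
    (\<forall>D. (proj has_derivative D) (at w) \<longrightarrow> norm (proj w - proj z - D (w - z)) \<le> \<epsilon> * norm (w - z))"

text \<open>If \<open>z\<close> is in \<open>A\<close>, the error vanishes because
  \<open>D = L\<close>; if not, points near \<open>z\<close> avoid the closed set
  \<open>A\<close>.\<close>

lemma linear_piece_error:
  assumes "linear_piece A L" "\<epsilon> > 0"
  shows "\<forall>\<^sub>F w in nhds z. w \<in> A \<longrightarrow> small_error z \<epsilon> w"
proof (cases "z \<in> A")
  case True
  have A: "convex A" "bounded_linear L" "\<And>x. x \<in> A \<Longrightarrow> proj x = L x"
    using assms by (auto simp: linear_piece_def)
  obtain c e where c: "e > 0" "ball c e \<subseteq> A"
    using assms unfolding linear_piece_def by (auto simp: mem_interior)
  interpret L: bounded_linear L by (rule A)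
  have "small_error z \<epsilon> w" if "w \<in> A" for w
    unfolding small_error_def
  proof (intro allI impI)
    fix D assume "(proj has_derivative D) (at w)"
    then have "D = L"
      using derivative_on_linear_piece[OF A(1) c(2,1) A(2,3) that] by blast
    then show "norm (proj w - proj z - D (w - z)) \<le> \<epsilon> * norm (w - z)"
      using that True A(3) assms by (simp add: L.diff)
  qed
  then show ?thesis by simp
next
  case False
  moreover have "open (- A)" using assms by (simp add: linear_piece_def open_Compl)
  ultimately have "\<forall>\<^sub>F w in nhds z. w \<in> - A"
    by (intro eventually_nhds_in_open) auto
  then show ?thesis by eventually_elim simp
qed

text \<open>Closedness puts \<open>z\<close> into \<open>A\<close>, convexity then an initial
  segment of the ray, on which the quotient is constant.\<close>

lemma linear_piece_direction:
  assumes A: "linear_piece A L" and fr: "\<exists>\<^sub>F t in at_right 0. z + t *\<^sub>R d \<in> A"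
  shows "((\<lambda>t. (proj (z + t *\<^sub>R d) - proj z) /\<^sub>R t) \<longlongrightarrow> L d) (at_right 0)"
proof -
  have A: "closed A" "convex A" "bounded_linear L" "\<And>x. x \<in> A \<Longrightarrow> proj x = L x"
    using assms by (auto simp: linear_piece_def)
  interpret L: bounded_linear L by (rule A)
  have lim: "((\<lambda>t. z + t *\<^sub>R d) \<longlongrightarrow> z) (at_right 0)"
    by (auto intro!: tendsto_eq_intros)
  have z: "z \<in> A"
  proof (rule ccontr)
    assume "z \<notin> A"
    then have "\<forall>\<^sub>F t in at_right 0. z + t *\<^sub>R d \<in> - A"
      using topological_tendstoD[OF lim, of "- A"] A(1) by (simp add: open_Compl)
    then show False using fr by (simp add: frequently_def)
  qed
  have "\<exists>\<^sub>F t in at_right 0. z + t *\<^sub>R d \<in> A \<and> t > 0"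
    by (rule frequently_eventually_frequently[OF fr eventually_at_right_less])
  then obtain s where s: "z + s *\<^sub>R d \<in> A" "s > 0"
    using frequently_ex by blast
  have "\<forall>\<^sub>F t in at_right 0. L d = (proj (z + t *\<^sub>R d) - proj z) /\<^sub>R t"
  proof -
    have "\<forall>\<^sub>F t in at_right 0. t \<in> {0<..<s}"
      by (rule eventually_at_right_real[OF s(2)])
    then show ?thesis
    proof eventually_elim
      case (elim t)
      have "z + t *\<^sub>R d = (1 - t / s) *\<^sub>R z + (t / s) *\<^sub>R (z + s *\<^sub>R d)"
        using s by (simp add: algebra_simps)
      also have "\<dots> \<in> A"
        using elim by (intro convexD_alt A(2) z s(1)) auto
      finally show ?case
        using elim A(4) z by (simp add: L.add L.scaleR)
    qed
  qed
  then show ?thesis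
    by (rule Lim_transform_eventually[OF tendsto_const])
qed

lemma curved_approach_exists: "\<exists>\<alpha> \<beta> \<rho>. curved_approach \<alpha> \<beta> \<rho>"
proof -
  have "\<forall>w. \<exists>a b r. w \<in> curved \<longrightarrow> a > 0 \<and> b > 0 \<and> w = a *\<^sub>R pv r + b *\<^sub>R qv r"
    by (auto simp: curved_def)
  then obtain \<alpha> \<beta> \<rho> where "\<And>w. w \<in> curved \<Longrightarrow> \<alpha> w > 0 \<and> \<beta> w > 0 \<and> w = \<alpha> w *\<^sub>R pv (\<rho> w) + \<beta> w *\<^sub>R qv (\<rho> w)"
    by metis
  then show ?thesis by (auto simp: curved_approach_def)
qed

lemma curved_error:
  assumes "\<epsilon> > 0"
  shows "\<forall>\<^sub>F w in nhds z. w \<in> curved \<longrightarrow> small_error z \<epsilon> w"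
proof (cases "z = 0")
  case True
  \<comment> \<open>At the apex \<open>direction_limits\<close> does not apply, but there the error
    is \<open>proj w - D w\<close>, which is zero by homogeneity.\<close>
  have "small_error z \<epsilon> w" if "w \<in> curved" for w
    unfolding small_error_def
  proof (intro allI impI)
    fix D assume D: "(proj has_derivative D) (at w)"
    obtain a b r where w: "w = a *\<^sub>R pv r + b *\<^sub>R qv r" "a > 0" "b > 0"
      using \<open>w \<in> curved\<close> by (auto simp: curved_def)
    have "D w = proj w"
      using proj_derivative_curved[OF w(2,3) D[unfolded w(1)], of w] curved_frame[OF w] by simp
    then show "norm (proj w - proj z - D (w - z)) \<le> \<epsilon> * norm (w - z)"
      using True assms by (simp add: proj_0)
  qed
  then show ?thesis by simp
next
  case False
  obtain \<alpha> \<beta> \<rho> where "curved_approach \<alpha> \<beta> \<rho>" using curved_approach_exists by blast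
  then obtain \<Phi> \<kappa> P0 N0 where "curved_limit z \<alpha> \<beta> \<rho> \<Phi> \<kappa> P0 N0"
    using curved_approach.curved_limit_exists[OF _ False] by blast
  from curved_limit.derivative_error[OF this assms]
  have "\<forall>\<^sub>F w in nhds z. w \<noteq> z \<longrightarrow> w \<in> curved \<longrightarrow> small_error z \<epsilon> w"
    by (simp add: small_error_def eventually_at_filter)
  \<comment> \<open>The punctured filter leaves out \<open>w = z\<close>, where the error is zero
    because \<open>D 0 = 0\<close>.\<close>
  then show ?thesis
    by eventually_elim (auto simp: small_error_def dest: has_derivative_bounded_linear[THEN bounded_linear.linear, THEN linear_0])
qed

lemma proj_error:
  assumes "\<epsilon> > 0"
  shows "\<forall>\<^sub>F w in nhds z. small_error z \<epsilon> w"
  using curved_error[OF assms, of z] linear_piece_error[OF linear_piece_exp_cone assms, of z]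
    linear_piece_error[OF linear_piece_polar_cone assms, of z]
    linear_piece_error[OF linear_piece_quad(1) assms, of z] linear_piece_error[OF linear_piece_quad(2) assms, of z]
  by eventually_elim (use cover in blast)

lemma proj_directional: "\<exists>l. ((\<lambda>t. (proj (z + t *\<^sub>R d) - proj z) /\<^sub>R t) \<longlongrightarrow> l) (at_right 0)"
proof (cases "z = 0 \<or> d = 0")
  case True
  have "\<forall>\<^sub>F t in at_right 0. proj d = (proj (z + t *\<^sub>R d) - proj z) /\<^sub>R t"
    using eventually_at_right_less[of 0] by eventually_elim (use True in \<open>auto simp: proj_scaleR proj_0\<close>)
  then show ?thesis
    by (intro exI Lim_transform_eventually[OF tendsto_const])
next
  case False
  \<comment> \<open>Either the ray returns to one linear piece at arbitrarily small times, or by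
    \<open>cover\<close> it finally stays in the curved region.\<close>
  define freq where "freq A \<longleftrightarrow> (\<exists>\<^sub>F t in at_right 0. z + t *\<^sub>R d \<in> A)" for A
  show ?thesis
  proof (cases "freq exp_cone \<or> freq polar_cone \<or> freq quad_up \<or> freq quad_dn")
    case True
    then show ?thesis
      using linear_piece_direction linear_piece_exp_cone linear_piece_polar_cone linear_piece_quad
      unfolding freq_def by blast
  next
    case no: False
    have ev: "\<forall>\<^sub>F t in at_right 0. z + t *\<^sub>R d \<notin> A" if "\<not> freq A" for A
      using that by (simp add: freq_def frequently_def)
    have "\<forall>\<^sub>F t in at_right 0. z + t *\<^sub>R d \<notin> exp_cone" "\<forall>\<^sub>F t in at_right 0. z + t *\<^sub>R d \<notin> polar_cone"
      "\<forall>\<^sub>F t in at_right 0. z + t *\<^sub>R d \<notin> quad_up" "\<forall>\<^sub>F t in at_right 0. z + t *\<^sub>R d \<notin> quad_dn"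
      using no ev by auto
    then have "\<forall>\<^sub>F t in at_right 0. z + t *\<^sub>R d \<in> curved"
      by eventually_elim (use cover in blast)
    moreover obtain \<alpha> \<beta> \<rho> where "curved_approach \<alpha> \<beta> \<rho>" using curved_approach_exists by blast
    then obtain \<Phi> \<kappa> P0 N0 where "curved_limit z \<alpha> \<beta> \<rho> \<Phi> \<kappa> P0 N0"
      using curved_approach.curved_limit_exists False by blast
    ultimately show ?thesis
      using curved_limit.directional_derivative False by blast
  qed
qed

section \<open>From derivatives to the generalized Jacobian\<close>

lemma tendsto_matrix_vector_mult:
  fixes A :: "'a \<Rightarrow> real ^ 'n ^ 'm"
  assumes "(A \<longlongrightarrow> B) F" "(x \<longlongrightarrow> y) F"
  shows "((\<lambda>i. A i *v x i) \<longlongrightarrow> B *v y) F"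
  unfolding matrix_vector_mult_def
  by (intro tendsto_vec_lambda tendsto_sum tendsto_mult tendsto_vec_nth assms)

text \<open>For fixed \<delta> the matrices satisfying the bound form a convex set, the preimage of
  a ball under a linear map. It contains each limit of Jacobians, since the non-strict bounds of
  \<open>small_error\<close> along the sequence pass to the limit, and therefore their convex
  hull.\<close>

lemma generalized_jacobian_error:
  assumes "\<epsilon> > 0"
  shows "\<exists>\<eta>>0. \<forall>\<delta>. norm \<delta> < \<eta> \<longrightarrow> (\<forall>J \<in> generalized_jacobian proj (z + \<delta>).
    norm (proj (z + \<delta>) - proj z - J *v \<delta>) \<le> \<epsilon> * norm \<delta>)"
proof -
  obtain \<eta> where \<eta>: "\<eta> > 0" "\<And>w. dist w z < \<eta> \<Longrightarrow> small_error z \<epsilon> w"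
    using proj_error[OF assms, of z] unfolding eventually_nhds_metric by blast
  have "norm (proj (z + \<delta>) - proj z - J *v \<delta>) \<le> \<epsilon> * norm \<delta>"
    if \<delta>: "norm \<delta> < \<eta>" and J: "J \<in> generalized_jacobian proj (z + \<delta>)" for \<delta> J
  proof -
    define S where "S = {J. norm (proj (z + \<delta>) - proj z - J *v \<delta>) \<le> \<epsilon> * norm \<delta>}"
    have "S = (\<lambda>J. J *v \<delta>) -` cball (proj (z + \<delta>) - proj z) (\<epsilon> * norm \<delta>)"
      by (auto simp: S_def dist_norm)
    moreover have "linear (\<lambda>J :: real ^ 3 ^ 3. J *v \<delta>)"
      by (rule linearI) (simp_all add: matrix_vector_mult_add_rdistrib scaleR_matrix_vector_assoc)
    ultimately have cS: "convex S" by (simp add: convex_linear_vimage)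
    have "J \<in> S" if s: "s \<longlonglongrightarrow> z + \<delta>" "\<And>i. proj differentiable (at (s i))"
      "(\<lambda>i. jacobian proj (at (s i))) \<longlonglongrightarrow> J" for s J
    proof -
      have "\<forall>\<^sub>F i in sequentially. s i \<in> ball z \<eta>"
        using topological_tendstoD[OF s(1), of "ball z \<eta>"] \<delta> by (simp add: dist_norm)
      then have "\<forall>\<^sub>F i in sequentially. norm (proj (s i) - proj z - jacobian proj (at (s i)) *v (s i - z))
          \<le> \<epsilon> * norm (s i - z)"
      proof eventually_elim
        case (elim i)
        then have "small_error z \<epsilon> (s i)" by (intro \<eta>) (simp add: dist_commute)
        moreover have "(proj has_derivative (\<lambda>h. jacobian proj (at (s i)) *v h)) (at (s i))"
          using s(2) jacobian_works by blast
        ultimately show ?case unfolding small_error_def by blast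
      qed
      moreover have "(\<lambda>i. proj (s i)) \<longlonglongrightarrow> proj (z + \<delta>)"
        using continuous_on_tendsto_compose[OF continuous_on_proj[of UNIV] s(1)] by simp
      then have "(\<lambda>i. norm (proj (s i) - proj z - jacobian proj (at (s i)) *v (s i - z))) \<longlonglongrightarrow>
          norm (proj (z + \<delta>) - proj z - J *v (z + \<delta> - z))"
        by (intro tendsto_intros tendsto_matrix_vector_mult s)
      moreover have "(\<lambda>i. \<epsilon> * norm (s i - z)) \<longlonglongrightarrow> \<epsilon> * norm (z + \<delta> - z)"
        by (intro tendsto_intros s)
      ultimately have "norm (proj (z + \<delta>) - proj z - J *v (z + \<delta> - z)) \<le> \<epsilon> * norm (z + \<delta> - z)"
        by (intro tendsto_le[OF trivial_limit_sequentially])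
      then show ?thesis by (simp add: S_def)
    qed
    then have "generalized_jacobian proj (z + \<delta>) \<subseteq> S"
      unfolding generalized_jacobian_def by (intro hull_minimal cS) blast
    then show ?thesis using J by (auto simp: S_def)
  qed
  then show ?thesis using \<eta>(1) by blast
qed

theorem lemma3p2:
  shows "semismooth (closest_point exp_cone)"
  unfolding semismooth_def
proof (intro conjI allI impI)
  show "locally_lipschitz proj"
    unfolding locally_lipschitz_def
  proof
    fix z
    have "1-lipschitz_on (ball z 1) proj"
      by (rule lipschitz_onI) (use proj_lipschitz in \<open>simp_all add: dist_norm\<close>)
    then show "\<exists>r>0. \<exists>L. L-lipschitz_on (ball z r) proj"
      by (intro exI[of _ 1] conjI) auto
  qed
  show "directionally_differentiable proj"
    unfolding directionally_differentiable_def using proj_directional by blast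
  \<comment> \<open>Using half of \<epsilon> turns the non-strict bound into the strict one
    required.\<close>
  fix z :: "real ^ 3" and \<epsilon> :: real assume "\<epsilon> > 0"
  then obtain \<eta> where \<eta>: "\<eta> > 0" "\<And>\<delta> J. norm \<delta> < \<eta> \<Longrightarrow> J \<in> generalized_jacobian proj (z + \<delta>) \<Longrightarrow>
      norm (proj (z + \<delta>) - proj z - J *v \<delta>) \<le> \<epsilon> / 2 * norm \<delta>"
    using generalized_jacobian_error[of "\<epsilon> / 2" z] by auto
  have "norm (proj (z + \<delta>) - proj z - J *v \<delta>) / norm \<delta> < \<epsilon>"
    if "0 < norm \<delta>" "norm \<delta> < \<eta>" "J \<in> generalized_jacobian proj (z + \<delta>)" for \<delta> J
  proof -
    have "norm (proj (z + \<delta>) - proj z - J *v \<delta>) / norm \<delta> \<le> \<epsilon> / 2"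
      using \<eta>(2)[OF that(2,3)] that(1) by (simp add: divide_le_eq)
    then show ?thesis using \<open>\<epsilon> > 0\<close> by linarith
  qed
  then show "\<exists>\<eta>>0. \<forall>\<delta>. 0 < norm \<delta> \<and> norm \<delta> < \<eta> \<longrightarrow>
      (\<forall>J\<in>generalized_jacobian proj (z + \<delta>). norm (proj (z + \<delta>) - proj z - J *v \<delta>) / norm \<delta> < \<epsilon>)"
    using \<eta>(1) by blast
qed

end
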